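(* Let $K$ be a differential field of characteristic zero, let $n$ be a positive integer, let $(h_1,\ldots,h_n)\in\mathbb{Z}_{\geqslant 0}^n$, and let $H=h_1+\ldots+h_n$. For an integer $h$, denote by $I_h$ the ideal $$\left(y_1\cdots y_n,\ (y_1\cdots y_n)',\ \ldots,\ (y_1\cdots y_n)^{(h)}\right)\subset K\{y_1,\ldots,y_n\}.$$ Then: 1. The differential polynomial $y_1^{(h_1)}\cdots y_n^{(h_n)}$ does not lie in the radical of $I_{H-1}$. 2. The minimal $d$ such that $\left(y_1^{(h_1)}\cdots y_n^{(h_n)}\right)^d\in I_H$ is equal to $\max\limits_{1\leqslant i\leqslant n}(h_i+1)(H-h_i)+1$.
   Context: A differential field is a field $K$ with a derivation $a\mapsto a'$. $K\{y_1,\ldots,y_n\}$ is the ring of differential polynomials: the polynomial ring over $K$ in algebraically independent variables $y_i^{(j)}$ ($1\leqslant i\leqslant n$, $j\geqslant 0$, $y_i^{(0)}=y_i$), with the derivation extending that of $K$ and satisfying $(y_i^{(j)})'=y_i^{(j+1)}$. For an element $f$, $f^{(j)}$ denotes the $j$-th derivative. $I_h$ is the ordinary (not differential) ideal generated by the listed $h+1$ elements; for $h=-1$ the list of generators is empty and $I_{-1}=(0)$. In part 2, $d$ ranges over non-negative integers, and the expression means $\left(\max_i (h_i+1)(H-h_i)\right)+1$. *)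

theory Defs
  imports Complex_Main "HOL-Library.Poly_Mapping"
begin

definition derivation :: "('a::comm_ring_1 \<Rightarrow> 'a) \<Rightarrow> bool" where
  "derivation d \<longleftrightarrow>
     (\<forall>a b. d (a + b) = d a + d b) \<and> (\<forall>a b. d (a * b) = d a * b + a * d b)"


text \<open>
  The finite index type \<open>'n\<close> plays the role of \<open>{1, \<dots>, n}\<close>; finite types are
  nonempty, so \<open>n \<ge> 1\<close>.  The pair \<open>(i, j)\<close> stands for the variable \<open>y\<^sub>i\<^sup>(\<^sup>j\<^sup>)\<close>, a
  monomial is a finitely supported exponent vector on such pairs, and a differential
  polynomial maps finitely many monomials to nonzero coefficients.  Multiplication of
  \<open>Poly_Mapping\<close> is convolution, that is, polynomial multiplication.
\<close>

type_synonym 'n dmonom = "('n \<times> nat) \<Rightarrow>\<^sub>0 nat"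
type_synonym ('k, 'n) dpoly = "'n dmonom \<Rightarrow>\<^sub>0 'k"

definition dconst :: "'k::comm_ring_1 \<Rightarrow> ('k, 'n) dpoly" where
  "dconst c = Poly_Mapping.single 0 c"

definition dvar :: "'n \<Rightarrow> nat \<Rightarrow> ('k::comm_ring_1, 'n) dpoly" where
  "dvar i j = Poly_Mapping.single (Poly_Mapping.single (i, j) 1) 1"

text \<open>
  Derivative of the monomial \<open>m\<close>: each variable \<open>(i, j)\<close> of exponent \<open>e\<close> contributes
  \<open>e\<close> times the monomial in which one factor \<open>(i, j)\<close> is replaced by \<open>(i, j + 1)\<close>.
\<close>

definition monom_deriv :: "'n dmonom \<Rightarrow> ('k::comm_ring_1, 'n) dpoly" where
  "monom_deriv m = (\<Sum>(i, j)\<in>Poly_Mapping.keys m.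
     Poly_Mapping.single
       (m - Poly_Mapping.single (i, j) 1 + Poly_Mapping.single (i, Suc j) 1)
       (of_nat (Poly_Mapping.lookup m (i, j))))"

text \<open>
  The lemmas \<open>derivation_dderiv\<close>, \<open>dderiv_dconst\<close>, \<open>dderiv_dvar\<close> and \<open>dderiv_unique\<close>
  below show that this is the unique derivation extending \<open>\<delta>\<close> and sending each \<open>(i, j)\<close>
  to \<open>(i, j + 1)\<close>.
\<close>

definition dderiv :: "('k::comm_ring_1 \<Rightarrow> 'k) \<Rightarrow> ('k, 'n) dpoly \<Rightarrow> ('k, 'n) dpoly" where
  "dderiv \<delta> p = (\<Sum>m\<in>Poly_Mapping.keys p.
     Poly_Mapping.single m (\<delta> (Poly_Mapping.lookup p m))
     + dconst (Poly_Mapping.lookup p m) * monom_deriv m)"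

lemma derivation_add: "derivation d \<Longrightarrow> d (a + b) = d a + d b"
  and derivation_mult: "derivation d \<Longrightarrow> d (a * b) = d a * b + a * d b"
  by (auto simp: derivation_def)

lemma derivation_0: "derivation d \<Longrightarrow> d 0 = 0"
  using derivation_add[of d 0 0] by simp

lemma derivation_1: "derivation d \<Longrightarrow> d 1 = 0"
  using derivation_mult[of d 1 1] by simp

lemma derivation_sum: "derivation d \<Longrightarrow> d (sum f A) = (\<Sum>x\<in>A. d (f x))"
  by (induction A rule: infinite_finite_induct) (auto simp: derivation_0 derivation_add)

lemma dderiv_superset:
  assumes "derivation \<delta>" "finite A" "Poly_Mapping.keys p \<subseteq> A"
  shows "dderiv \<delta> p = (\<Sum>m\<in>A. Poly_Mapping.single m (\<delta> (Poly_Mapping.lookup p m))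
     + dconst (Poly_Mapping.lookup p m) * monom_deriv m)"
  unfolding dderiv_def
  by (rule sum.mono_neutral_left)
    (use assms in \<open>auto simp: in_keys_iff dconst_def derivation_0\<close>)

lemma dderiv_add:
  assumes "derivation \<delta>"
  shows "dderiv \<delta> (p + q) = dderiv \<delta> p + dderiv \<delta> q"
proof -
  let ?A = "Poly_Mapping.keys p \<union> Poly_Mapping.keys q"
  have "dderiv \<delta> r = (\<Sum>m\<in>?A. Poly_Mapping.single m (\<delta> (Poly_Mapping.lookup r m))
     + dconst (Poly_Mapping.lookup r m) * monom_deriv m)"
    if "Poly_Mapping.keys r \<subseteq> ?A" for r
    using dderiv_superset[OF assms _ that] by simp
  from this[of p] this[of q] this[of "p + q"] keys_add[of p q] show ?thesis
    by (simp add: lookup_add derivation_add[OF assms] single_add dconst_def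
        distrib_right sum.distrib)
qed

lemma dderiv_single:
  assumes "derivation \<delta>"
  shows "dderiv \<delta> (Poly_Mapping.single m c)
    = Poly_Mapping.single m (\<delta> c) + dconst c * monom_deriv m"
  using dderiv_superset[OF assms, of "{m}" "Poly_Mapping.single m c"] by simp

lemma dderiv_dconst: "derivation \<delta> \<Longrightarrow> dderiv \<delta> (dconst c) = dconst (\<delta> c)"
  unfolding dconst_def by (subst dderiv_single) (auto simp: monom_deriv_def)

lemma dderiv_dvar: "derivation \<delta> \<Longrightarrow> dderiv \<delta> (dvar i j) = dvar i (Suc j)"
  unfolding dvar_def
  by (subst dderiv_single) (auto simp: monom_deriv_def dconst_def derivation_1)

lemma monom_deriv_superset:
  assumes "finite A" "Poly_Mapping.keys m \<subseteq> A"
  shows "monom_deriv m = (\<Sum>(i, j)\<in>A.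
     Poly_Mapping.single
       (m - Poly_Mapping.single (i, j) 1 + Poly_Mapping.single (i, Suc j) 1)
       (of_nat (Poly_Mapping.lookup m (i, j))))"
  unfolding monom_deriv_def
  by (rule sum.mono_neutral_left) (use assms in \<open>auto simp: in_keys_iff\<close>)

lemma monom_diff_single_add:
  fixes m m' :: "'n dmonom"
  assumes "Poly_Mapping.lookup m v \<noteq> 0"
  shows "m - Poly_Mapping.single v 1 + m' = m + m' - Poly_Mapping.single v 1"
  by (rule poly_mapping_eqI)
    (use assms in \<open>auto simp: lookup_add lookup_minus lookup_single when_def\<close>)

lemma monom_deriv_add:
  fixes m m' :: "'n dmonom"
  shows "(monom_deriv (m + m') :: ('k::comm_ring_1, 'n) dpoly)
    = monom_deriv m * Poly_Mapping.single m' 1 + Poly_Mapping.single m 1 * monom_deriv m'"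
proof -
  let ?A = "Poly_Mapping.keys m \<union> Poly_Mapping.keys m'"
  define s :: "'n dmonom \<Rightarrow> 'n \<times> nat \<Rightarrow> nat \<Rightarrow> ('k, 'n) dpoly" where
    "s x v e = Poly_Mapping.single
       (x - Poly_Mapping.single v 1 + Poly_Mapping.single (fst v, Suc (snd v)) 1) (of_nat e)"
    for x v e
  have ex: "(monom_deriv x :: ('k, 'n) dpoly) = (\<Sum>v\<in>?A. s x v (Poly_Mapping.lookup x v))"
    if "Poly_Mapping.keys x \<subseteq> ?A" for x
    using monom_deriv_superset[OF _ that] by (simp add: s_def case_prod_unfold)
  have 1: "s x v (Poly_Mapping.lookup x v) * Poly_Mapping.single y 1
      = s (x + y) v (Poly_Mapping.lookup x v)" for x y v
  proof (cases "Poly_Mapping.lookup x v = 0")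
    case False
    from monom_diff_single_add[OF this, of y] show ?thesis
      by (simp add: s_def mult_single add_ac)
        (metis (no_types, lifting) add.commute add.left_commute)
  qed (simp add: s_def)
  have 2: "s x v (a + b) = s x v a + s x v b" for x v a b
    by (simp add: s_def single_add)
  have "(monom_deriv (m + m') :: ('k, 'n) dpoly)
      = (\<Sum>v\<in>?A. s (m + m') v (Poly_Mapping.lookup m v))
        + (\<Sum>v\<in>?A. s (m + m') v (Poly_Mapping.lookup m' v))"
    using ex[of "m + m'"] keys_add[of m m'] by (simp add: lookup_add 2 sum.distrib)
  also have "(\<Sum>v\<in>?A. s (m + m') v (Poly_Mapping.lookup m v))
      = monom_deriv m * Poly_Mapping.single m' 1"
    by (subst ex) (auto simp: sum_distrib_right 1)
  also have "(\<Sum>v\<in>?A. s (m + m') v (Poly_Mapping.lookup m' v))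
      = monom_deriv m' * Poly_Mapping.single m 1"
    by (subst ex) (auto simp: sum_distrib_right 1 add.commute)
  finally show ?thesis by (simp add: mult.commute)
qed

lemma poly_mapping_sum_single:
  "p = (\<Sum>m\<in>Poly_Mapping.keys p. Poly_Mapping.single m (Poly_Mapping.lookup p m))"
  by (rule poly_mapping_eqI)
    (auto simp: lookup_sum lookup_single when_def in_keys_iff)

lemma dpoly_induct:
  fixes p :: "'m \<Rightarrow>\<^sub>0 'k::comm_ring_1"
  assumes "P 0" "\<And>m c. P (Poly_Mapping.single m c)" "\<And>p q. P p \<Longrightarrow> P q \<Longrightarrow> P (p + q)"
  shows "P p"
proof -
  have "P (\<Sum>m\<in>A. Poly_Mapping.single m (Poly_Mapping.lookup p m))" for A
    by (induction A rule: infinite_finite_induct) (auto intro: assms)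
  then show ?thesis by (subst poly_mapping_sum_single)
qed

lemma derivation_dderiv:
  fixes \<delta> :: "'k::comm_ring_1 \<Rightarrow> 'k"
  assumes d: "derivation \<delta>"
  shows "derivation (dderiv \<delta> :: ('k, 'n) dpoly \<Rightarrow> _)"
proof -
  let ?D = "dderiv \<delta> :: ('k, 'n) dpoly \<Rightarrow> _"
  have sc: "Poly_Mapping.single m c = dconst c * Poly_Mapping.single m 1"
    for m :: "'n dmonom" and c :: 'k
    by (simp add: dconst_def mult_single)
  have cm: "dconst (a * b) = dconst a * dconst b" "dconst (a + b) = dconst a + dconst b"
    for a b :: 'k
    by (simp_all add: dconst_def mult_single single_add)
  have ss: "?D (Poly_Mapping.single m a * Poly_Mapping.single m' b)
     = ?D (Poly_Mapping.single m a) * Poly_Mapping.single m' b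
       + Poly_Mapping.single m a * ?D (Poly_Mapping.single m' b)" for m m' a b
  proof -
    have 1: "Poly_Mapping.single (m + m') (1::'k)
        = Poly_Mapping.single m 1 * Poly_Mapping.single m' 1"
      by (simp add: mult_single)
    show ?thesis
      unfolding mult_single dderiv_single[OF d] monom_deriv_add derivation_mult[OF d]
      unfolding sc[of _ "_ + _"] sc[of m a] sc[of m' b] sc[of m "\<delta> a"] sc[of m' "\<delta> b"] cm 1
      by (simp add: algebra_simps)
  qed
  have sq: "?D (Poly_Mapping.single m a * q)
     = ?D (Poly_Mapping.single m a) * q + Poly_Mapping.single m a * ?D q" for m a q
    by (induction q rule: dpoly_induct)
      (simp_all add: ss dderiv_add[OF d] distrib_left add_ac, simp add: dderiv_def)
  have "?D (p * q) = ?D p * q + p * ?D q" for p q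
    by (induction p rule: dpoly_induct)
      (simp_all add: sq dderiv_add[OF d] distrib_right add_ac, simp add: dderiv_def)
  then show ?thesis
    by (auto simp: derivation_def dderiv_add[OF d])
qed

lemma dderiv_unique:
  fixes D :: "('k::comm_ring_1, 'n) dpoly \<Rightarrow> ('k, 'n) dpoly"
  assumes D: "derivation D" and \<delta>: "derivation \<delta>"
    and "\<And>c. D (dconst c) = dconst (\<delta> c)" "\<And>i j. D (dvar i j) = dvar i (Suc j)"
  shows "D = dderiv \<delta>"
proof
  let ?E = "dderiv \<delta> :: ('k, 'n) dpoly \<Rightarrow> _"
  note E = derivation_dderiv[OF \<delta>, where 'n = 'n]
  have pw: "D (Poly_Mapping.single (Poly_Mapping.single v e) 1)
      = ?E (Poly_Mapping.single (Poly_Mapping.single v e) 1)" for v e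
  proof (induction e)
    case 0
    then show ?case by (simp add: derivation_1[OF D] derivation_1[OF E])
  next
    case (Suc e)
    obtain i j where v: "v = (i, j)" by fastforce
    have "Poly_Mapping.single (Poly_Mapping.single v (Suc e)) (1::'k)
        = dvar i j * Poly_Mapping.single (Poly_Mapping.single v e) 1"
      by (simp add: dvar_def v mult_single flip: single_add)
    then show ?case
      by (simp add: derivation_mult[OF D] derivation_mult[OF E] Suc.IH assms dderiv_dvar[OF \<delta>])
  qed
  have "D (Poly_Mapping.single (\<Sum>v\<in>A. Poly_Mapping.single v (Poly_Mapping.lookup m v)) 1)
      = ?E (Poly_Mapping.single (\<Sum>v\<in>A. Poly_Mapping.single v (Poly_Mapping.lookup m v)) 1)"
    if "finite A" for A and m :: "'n dmonom"
    using that
  proof (induction A)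
    case empty
    then show ?case by (simp add: derivation_1[OF D] derivation_1[OF E])
  next
    case (insert v A)
    have "Poly_Mapping.single (x + y) (1::'k) = Poly_Mapping.single x 1 * Poly_Mapping.single y 1"
      for x y :: "'n dmonom"
      by (simp add: mult_single)
    with insert show ?case
      by (simp add: derivation_mult[OF D] derivation_mult[OF E] pw)
  qed
  moreover have "m = (\<Sum>v\<in>Poly_Mapping.keys m. Poly_Mapping.single v (Poly_Mapping.lookup m v))"
    for m :: "'n dmonom"
    by (rule poly_mapping_eqI)
      (auto simp: lookup_sum lookup_single when_def in_keys_iff)
  ultimately have m1: "D (Poly_Mapping.single m 1) = ?E (Poly_Mapping.single m 1)" for m
    by (metis finite_keys)
  have sc: "Poly_Mapping.single m c = dconst c * Poly_Mapping.single m 1"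
    for m :: "'n dmonom" and c :: 'k
    by (simp add: dconst_def mult_single)
  have "D (Poly_Mapping.single m c) = ?E (Poly_Mapping.single m c)" for m c
    unfolding sc[of m c] derivation_mult[OF D] derivation_mult[OF E]
    by (simp add: m1 assms dderiv_dconst[OF \<delta>])
  then show "D p = ?E p" for p
    by (induction p rule: dpoly_induct)
      (simp_all add: derivation_0[OF D] derivation_0[OF E]
        derivation_add[OF D] derivation_add[OF E])
qed


text \<open>Ideals of a commutative ring are its submodules as a module over itself.\<close>

lemma module_mult: "module ((*) :: 'a::comm_ring_1 \<Rightarrow> 'a \<Rightarrow> 'a)"
  by unfold_locales (auto simp: algebra_simps)

definition ideal_gen :: "'a::comm_ring_1 set \<Rightarrow> 'a set" where
  "ideal_gen S = module.span (*) S"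

definition radical :: "'a::comm_ring_1 set \<Rightarrow> 'a set" where
  "radical J = {f. \<exists>m>0. f ^ m \<in> J}"

text \<open>
  The ideal \<open>I\<^sub>h\<close>.  The bound \<open>h\<close> is an integer so that \<open>h = -1\<close> gives an empty list of
  generators, hence the zero ideal.
\<close>

definition I_ideal :: "('k::comm_ring_1 \<Rightarrow> 'k) \<Rightarrow> int \<Rightarrow> ('k, 'n::finite) dpoly set" where
  "I_ideal \<delta> h =
     ideal_gen {(dderiv \<delta> ^^ k) (\<Prod>i\<in>UNIV. dvar i 0) | k. int k \<le> h}"

lemma I_ideal_minus_1: "I_ideal \<delta> (- 1) = {0}"
  using module.span_empty[OF module_mult] by (simp add: I_ideal_def ideal_gen_def)

end

theory Submission
  imports
    Defs
    "HOL-Computational_Algebra.Formal_Power_Series"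
    "HOL-Combinatorics.Permutations"
begin

hide_const (open) Formal_Power_Series.radical

text \<open>
  Put \<open>x\<^sub>i\<^sub>j = y\<^sub>i\<^sup>(\<^sup>j\<^sup>) / j!\<close> and \<open>X\<^sub>i(t) = \<Sum>\<^sub>j x\<^sub>i\<^sub>j t\<^sup>j\<close>; then \<open>I\<^sub>h\<close> is generated by the coefficients
  \<open>G\<^sub>0, \<dots>, G\<^sub>h\<close> of \<open>\<Prod>\<^sub>i X\<^sub>i(t)\<close>, and with \<open>N = H + 1\<close> the question is about
  \<open>\<Prod>\<^sub>i X\<^sub>i \<equiv> 0\<close> modulo \<open>t\<^sup>N\<close>.

  Upper bound.  The \<open>G\<^sub>k\<close> form a regular sequence: \<open>G\<^sub>0\<close> is the product of the \<open>x\<^sub>i\<^sub>0\<close>, and modulo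
  one of them the remaining \<open>G\<^sub>k\<close> are those of the problem with \<open>X\<^sub>i\<close> shifted.  So it is
  enough to show that the power of \<open>w\<close> is killed by a power of \<open>G\<^sub>N\<close>, hence by powers of the
  terms \<open>u\<^sub>a = \<Prod>\<^sub>i x\<^sub>i\<^sub>a\<^sub>i\<close> of \<open>G\<^sub>N\<close>, for \<open>a\<close> of sum \<open>N\<close>.  Some \<open>a\<^sub>i\<close> exceeds \<open>h\<^sub>i\<close>.  Where \<open>u\<^sub>a\<close> is
  invertible, all \<open>x\<^sub>j\<^sub>k\<close> with \<open>k < a\<^sub>j\<close> are nilpotent, and the problem is reduced to the two series
  \<open>X\<^sub>i\<close> and \<open>\<Prod>\<^sub>j\<^sub>\<noteq>\<^sub>i X\<^sub>j\<close>, where every product of \<open>p\<close> coefficients of the one and \<open>q\<close> of the other vanishes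
  for weight reasons if its weight is small.

  Lower bound.  Fix \<open>i\<close> and send \<open>X\<^sub>i\<close> and the other \<open>X\<^sub>j\<close> to products of \<open>h\<^sub>i + 1\<close>, respectively \<open>h\<^sub>j\<close>,
  distinct factors among \<open>t - z\<^sub>0, \<dots>, t - z\<^sub>H\<close>.  Then \<open>G\<^sub>0, \<dots>, G\<^sub>H\<close> become elementary symmetric
  polynomials up to sign and \<open>w\<close> becomes a multiple of \<open>z\<^sub>0 + \<dots> + z\<^sub>k\<^sub>-\<^sub>1\<close> with \<open>k = h\<^sub>i + 1\<close>, the hyperplane class of
  a Grassmannian of dimension \<open>k (N - k) = (h\<^sub>i + 1) (H - h\<^sub>i)\<close>, whose top power is not zero.
\<close>

section \<open>Ideals\<close>

definition is_ideal :: "'a::comm_ring_1 set \<Rightarrow> bool" where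
  "is_ideal J \<longleftrightarrow> 0 \<in> J \<and> (\<forall>a\<in>J. \<forall>b\<in>J. a + b \<in> J) \<and> (\<forall>r. \<forall>a\<in>J. r * a \<in> J)"

lemma is_idealI:
  assumes "0 \<in> J" "\<And>a b. a \<in> J \<Longrightarrow> b \<in> J \<Longrightarrow> a + b \<in> J" "\<And>r a. a \<in> J \<Longrightarrow> r * a \<in> J"
  shows "is_ideal J"
  using assms by (auto simp: is_ideal_def)

context
  fixes J :: "'a::comm_ring_1 set"
  assumes J: "is_ideal J"
begin

lemma ideal_0: "0 \<in> J"
  and ideal_add: "a \<in> J \<Longrightarrow> b \<in> J \<Longrightarrow> a + b \<in> J"
  and ideal_mult_left: "a \<in> J \<Longrightarrow> r * a \<in> J"
  using J by (auto simp: is_ideal_def)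

lemma ideal_mult_right: "a \<in> J \<Longrightarrow> a * r \<in> J"
  using ideal_mult_left[of a r] by (simp add: mult.commute)

lemma ideal_uminus: "a \<in> J \<Longrightarrow> - a \<in> J"
  using ideal_mult_left[of a "-1"] by simp

lemma ideal_diff: "a \<in> J \<Longrightarrow> b \<in> J \<Longrightarrow> a - b \<in> J"
  using ideal_add[of a "- b"] ideal_uminus[of b] by simp

lemma ideal_add_iff: "a \<in> J \<Longrightarrow> a + b \<in> J \<longleftrightarrow> b \<in> J"
  using ideal_add[of a b] ideal_diff[of "a + b" a] by auto

lemma ideal_sum: "(\<And>x. x \<in> A \<Longrightarrow> f x \<in> J) \<Longrightarrow> sum f A \<in> J"
  by (induction A rule: infinite_finite_induct) (auto intro: ideal_0 ideal_add)

lemma ideal_dvd: "a \<in> J \<Longrightarrow> a dvd b \<Longrightarrow> b \<in> J"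
  by (auto simp: dvd_def intro: ideal_mult_right)

lemma ideal_colon: "is_ideal {z. z * m \<in> J}"
  by (rule is_idealI) (auto simp: ideal_0 algebra_simps intro: ideal_add ideal_mult_left)

lemma ideal_radical_add:
  assumes "u ^ k \<in> J" "v ^ l \<in> J"
  shows "(u + v) ^ (k + l) \<in> J"
  unfolding binomial_ring
proof (rule ideal_sum)
  fix i assume "i \<in> {..k + l}"
  then have "u ^ k dvd u ^ i \<or> v ^ l dvd v ^ (k + l - i)"
    by (cases "k \<le> i") (auto intro: le_imp_power_dvd)
  then show "of_nat (k + l choose i) * u ^ i * v ^ (k + l - i) \<in> J"
  proof
    assume "u ^ k dvd u ^ i"
    then show ?thesis
      by (intro ideal_mult_right ideal_mult_left ideal_dvd[OF assms(1)])
  next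
    assume "v ^ l dvd v ^ (k + l - i)"
    then show ?thesis
      by (intro ideal_mult_left ideal_dvd[OF assms(2)])
  qed
qed

lemma ideal_radical: "is_ideal {z. \<exists>k. z ^ k \<in> J}"
proof (rule is_idealI)
  show "0 \<in> {z. \<exists>k. z ^ k \<in> J}"
    using ideal_0 by (auto intro!: exI[of _ 1])
next
  fix a b assume "a \<in> {z. \<exists>k. z ^ k \<in> J}" "b \<in> {z. \<exists>k. z ^ k \<in> J}"
  then show "a + b \<in> {z. \<exists>k. z ^ k \<in> J}"
    using ideal_radical_add by blast
next
  fix r a assume "a \<in> {z. \<exists>k. z ^ k \<in> J}"
  then obtain k where "a ^ k \<in> J"
    by auto
  then have "(r * a) ^ k \<in> J"
    by (simp add: power_mult_distrib ideal_mult_left)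
  then show "r * a \<in> {z. \<exists>k. z ^ k \<in> J}"
    by auto
qed

text \<open>These are the elements that die in the quotient by J once u is inverted, so this ideal
  stands in for localisation without any fractions.\<close>

lemma ideal_saturation: "is_ideal {z. \<exists>k. z * u ^ k \<in> J}"
proof (rule is_idealI)
  show "0 \<in> {z. \<exists>k. z * u ^ k \<in> J}"
    using ideal_0 by simp
next
  fix a b assume "a \<in> {z. \<exists>k. z * u ^ k \<in> J}" "b \<in> {z. \<exists>k. z * u ^ k \<in> J}"
  then obtain k l where "a * u ^ k \<in> J" "b * u ^ l \<in> J"
    by auto
  then have "a * u ^ k * u ^ l + b * u ^ l * u ^ k \<in> J"
    by (simp only: ideal_add ideal_mult_right)
  then show "a + b \<in> {z. \<exists>k. z * u ^ k \<in> J}"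
    by (auto simp: power_add algebra_simps intro!: exI[of _ "k + l"])
next
  fix r a assume "a \<in> {z. \<exists>k. z * u ^ k \<in> J}"
  then obtain k where "a * u ^ k \<in> J"
    by auto
  then have "r * a * u ^ k \<in> J"
    by (simp add: mult.assoc ideal_mult_left)
  then show "r * a \<in> {z. \<exists>k. z * u ^ k \<in> J}"
    by auto
qed

end

lemma is_ideal_iff_subspace: "is_ideal J \<longleftrightarrow> module.subspace (*) J"
  unfolding is_ideal_def module.subspace_def[OF module_mult] by auto

lemma is_ideal_ideal_gen [simp]: "is_ideal (ideal_gen S)"
  unfolding is_ideal_iff_subspace ideal_gen_def
  by (rule module.subspace_span[OF module_mult])

lemma ideal_gen_base: "a \<in> S \<Longrightarrow> a \<in> ideal_gen S"
  unfolding ideal_gen_def by (rule module.span_base[OF module_mult])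

lemma ideal_gen_least: "S \<subseteq> J \<Longrightarrow> is_ideal J \<Longrightarrow> ideal_gen S \<subseteq> J"
  unfolding is_ideal_iff_subspace ideal_gen_def by (rule module.span_minimal[OF module_mult])

lemma ideal_gen_mono: "S \<subseteq> T \<Longrightarrow> ideal_gen S \<subseteq> ideal_gen T"
  unfolding ideal_gen_def by (rule module.span_mono[OF module_mult])

lemma ideal_gen_eqI:
  assumes "S \<subseteq> ideal_gen T" "T \<subseteq> ideal_gen S"
  shows "ideal_gen S = ideal_gen T"
  by (intro equalityI ideal_gen_least assms is_ideal_ideal_gen)

lemma ideal_gen_insert: "ideal_gen (insert a S) = {x. \<exists>r. x - r * a \<in> ideal_gen S}"
  unfolding ideal_gen_def by (rule module.span_insert[OF module_mult])

lemma ideal_gen_insertI: "x - r * a \<in> ideal_gen S \<Longrightarrow> x \<in> ideal_gen (insert a S)"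
  by (auto simp: ideal_gen_insert)

lemma ideal_gen_insertE:
  assumes "x \<in> ideal_gen (insert a S)"
  obtains r y where "y \<in> ideal_gen S" "x = r * a + y"
  using assms that[of "x - _ * a"] by (auto simp: ideal_gen_insert)

lemma ideal_gen_insert_cong:
  assumes "a - b \<in> ideal_gen S" "ideal_gen S = ideal_gen T"
  shows "ideal_gen (insert a S) = ideal_gen (insert b T)"
proof -
  have "x - r * a \<in> ideal_gen S \<longleftrightarrow> x - r * b \<in> ideal_gen T" for x r
    using ideal_add_iff[OF is_ideal_ideal_gen ideal_mult_left[OF is_ideal_ideal_gen assms(1), of r],
        of "x - r * a"] assms(2)
    by (simp add: algebra_simps)
  then show ?thesis
    by (simp add: ideal_gen_insert)
qed

section \<open>Regular sequences\<close>

definition nzd :: "'a::comm_ring_1 set \<Rightarrow> 'a \<Rightarrow> bool" where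
  "nzd S g \<longleftrightarrow> (\<forall>p. p * g \<in> ideal_gen S \<longrightarrow> p \<in> ideal_gen S)"

text \<open>Weak regularity: the quotient may become zero. This makes the empty product 1 a valid
  base case in \<open>regular_seq_insert_prod\<close>.\<close>

fun regular_seq :: "'a::comm_ring_1 set \<Rightarrow> 'a list \<Rightarrow> bool" where
  "regular_seq S [] \<longleftrightarrow> True"
| "regular_seq S (g # gs) \<longleftrightarrow> nzd S g \<and> regular_seq (insert g S) gs"

lemma nzdD: "nzd S g \<Longrightarrow> p * g \<in> ideal_gen S \<Longrightarrow> p \<in> ideal_gen S"
  by (auto simp: nzd_def)

lemma nzd_cong:
  assumes "a - b \<in> ideal_gen S" "ideal_gen S = ideal_gen T"
  shows "nzd S a \<longleftrightarrow> nzd T b"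
proof -
  have "p * a \<in> ideal_gen S \<longleftrightarrow> p * b \<in> ideal_gen T" for p
    using ideal_add_iff[OF is_ideal_ideal_gen ideal_mult_left[OF is_ideal_ideal_gen assms(1), of p],
        of "p * b"] assms(2)
    by (simp add: algebra_simps)
  then show ?thesis
    using assms(2) by (simp add: nzd_def)
qed

lemma nzd_mult: "nzd S a \<Longrightarrow> nzd S b \<Longrightarrow> nzd S (a * b)"
  by (metis mult.assoc nzd_def)

lemma nzd_prod: "(\<And>i. i \<in> A \<Longrightarrow> nzd S (f i)) \<Longrightarrow> nzd S (prod f A)"
  by (induction A rule: infinite_finite_induct) (simp_all add: nzd_mult, simp_all add: nzd_def)

lemma nzd_power: "nzd S g \<Longrightarrow> nzd S (g ^ k)"
  by (induction k) (simp_all add: nzd_mult, simp add: nzd_def)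

lemma regular_seq_cong:
  assumes "list_all2 (\<lambda>a b. a - b \<in> ideal_gen S) gs hs" "ideal_gen S = ideal_gen T"
  shows "regular_seq S gs \<longleftrightarrow> regular_seq T hs"
  using assms
proof (induction gs arbitrary: S T hs)
  case (Cons g gs)
  then obtain h hs' where hs: "hs = h # hs'" "g - h \<in> ideal_gen S"
    "list_all2 (\<lambda>a b. a - b \<in> ideal_gen S) gs hs'"
    by (auto simp: list_all2_Cons1)
  have "list_all2 (\<lambda>a b. a - b \<in> ideal_gen (insert g S)) gs hs'"
    by (rule list_all2_mono[OF hs(3)]) (use ideal_gen_mono[OF subset_insertI] in blast)
  then have "regular_seq (insert g S) gs \<longleftrightarrow> regular_seq (insert h T) hs'"
    by (rule Cons.IH) (rule ideal_gen_insert_cong[OF hs(2) Cons.prems(2)])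
  then show ?case
    unfolding hs(1) using nzd_cong[OF hs(2) Cons.prems(2)] by simp
qed auto

lemma regular_seq_append:
  "regular_seq S (gs @ hs) \<longleftrightarrow> regular_seq S gs \<and> regular_seq (set gs \<union> S) hs"
  by (induction gs arbitrary: S) auto

lemma regular_seq_unit: "1 \<in> ideal_gen S \<Longrightarrow> regular_seq S gs"
proof (induction gs arbitrary: S)
  case (Cons g gs)
  have "p \<in> ideal_gen S" for p
    using ideal_mult_left[OF is_ideal_ideal_gen Cons.prems, of p] by simp
  with Cons show ?case
    using ideal_gen_mono[of S "insert g S"] by (auto simp: nzd_def)
qed auto

text \<open>This is the half of the permutability of a regular pair b, g that holds in every
  commutative ring. From p * b = q * g modulo S, regularity of g modulo b makes q a multiple of b,
  and b can then be cancelled.\<close>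

lemma nzd_insert_swap:
  assumes "nzd S b" "nzd (insert b S) g"
  shows "nzd (insert g S) b"
  unfolding nzd_def
proof (intro allI impI)
  note I = is_ideal_ideal_gen[of S]
  fix p assume "p * b \<in> ideal_gen (insert g S)"
  then obtain q y where q: "y \<in> ideal_gen S" "p * b = q * g + y"
    by (rule ideal_gen_insertE)
  then have "q * g - p * b \<in> ideal_gen S"
    using ideal_uminus[OF I q(1)] by simp
  then have "q \<in> ideal_gen (insert b S)"
    by (rule ideal_gen_insertI[THEN nzdD[OF assms(2)]])
  then obtain q' z where q': "z \<in> ideal_gen S" "q = q' * b + z"
    by (rule ideal_gen_insertE)
  have "(p - q' * g) * b = z * g + y"
    using q(2) q'(2) by (simp add: algebra_simps)
  then have "(p - q' * g) * b \<in> ideal_gen S"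
    using I q(1) q'(1) by (simp add: ideal_add ideal_mult_right)
  then show "p \<in> ideal_gen (insert g S)"
    by (rule nzdD[OF assms(1), THEN ideal_gen_insertI])
qed

text \<open>Multiplication by b embeds the quotient by a into the quotient by a * b, with cokernel
  the quotient by b. As g acts injectively on both ends, it does so in the middle.\<close>

lemma nzd_insert_mult:
  assumes b: "nzd S b" and ga: "nzd (insert a S) g" and gb: "nzd (insert b S) g"
  shows "nzd (insert (a * b) S) g"
  unfolding nzd_def
proof (intro allI impI)
  note I = is_ideal_ideal_gen[of S]
  fix p assume "p * g \<in> ideal_gen (insert (a * b) S)"
  then obtain r y where r: "y \<in> ideal_gen S" "p * g = r * (a * b) + y"
    by (rule ideal_gen_insertE)
  then have "p * g - r * a * b \<in> ideal_gen S"
    by (simp add: mult.assoc)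
  then have "p \<in> ideal_gen (insert b S)"
    by (rule ideal_gen_insertI[THEN nzdD[OF gb]])
  then obtain p' z where p': "z \<in> ideal_gen S" "p = p' * b + z"
    by (rule ideal_gen_insertE)
  have "(p' * g - r * a) * b = y - z * g"
    using r(2) p'(2) by (simp add: algebra_simps)
  then have "(p' * g - r * a) * b \<in> ideal_gen S"
    using I r(1) p'(1) by (simp add: ideal_diff ideal_mult_right)
  then have "p' * g - r * a \<in> ideal_gen S"
    by (rule nzdD[OF b])
  then have "p' \<in> ideal_gen (insert a S)"
    by (rule ideal_gen_insertI[THEN nzdD[OF ga]])
  then obtain s u where s: "u \<in> ideal_gen S" "p' = s * a + u"
    by (rule ideal_gen_insertE)
  have "p - s * (a * b) = u * b + z"
    using p'(2) s(2) by (simp add: algebra_simps)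
  then have "p - s * (a * b) \<in> ideal_gen S"
    using I s(1) p'(1) by (simp add: ideal_add ideal_mult_right)
  then show "p \<in> ideal_gen (insert (a * b) S)"
    by (rule ideal_gen_insertI)
qed

text \<open>\<open>nzd_insert_swap\<close> keeps b a nonzerodivisor after g is adjoined, so that
  \<open>nzd_insert_mult\<close> applies to each member of the sequence in turn.\<close>

lemma regular_seq_insert_mult:
  assumes "nzd S b" "regular_seq (insert a S) gs" "regular_seq (insert b S) gs"
  shows "regular_seq (insert (a * b) S) gs"
  using assms
proof (induction gs arbitrary: S)
  case (Cons g gs)
  have "regular_seq (insert (a * b) (insert g S)) gs"
  proof (rule Cons.IH)
    show "nzd (insert g S) b"
      using Cons.prems by (simp add: nzd_insert_swap)
    show "regular_seq (insert a (insert g S)) gs" "regular_seq (insert b (insert g S)) gs"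
      using Cons.prems(2,3) by (simp_all only: regular_seq.simps insert_commute[of g])
  qed
  moreover have "nzd (insert (a * b) S) g"
    using Cons.prems by (simp add: nzd_insert_mult)
  ultimately show ?case
    by (simp only: regular_seq.simps insert_commute[of g])
qed auto

lemma regular_seq_insert_prod:
  assumes "finite A" "\<And>i. i \<in> A \<Longrightarrow> nzd S (z i)" "\<And>i. i \<in> A \<Longrightarrow> regular_seq (insert (z i) S) gs"
  shows "regular_seq (insert (prod z A) S) gs"
  using assms
proof (induction A)
  case empty
  then show ?case by (auto intro!: regular_seq_unit ideal_gen_base)
next
  case (insert i A)
  then show ?case
    using regular_seq_insert_mult[of S "z i" "prod z A" gs] by (simp add: mult.commute)
qed

section \<open>Words in the coefficients of two series\<close>

definition conv :: "(nat \<Rightarrow> 'a::comm_ring_1) \<Rightarrow> (nat \<Rightarrow> 'a) \<Rightarrow> nat \<Rightarrow> 'a" where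
  "conv x y m = (\<Sum>k\<le>m. x k * y (m - k))"

abbreviation word :: "(nat \<Rightarrow> 'a::comm_ring_1) \<Rightarrow> nat list \<Rightarrow> 'a" where
  "word x is \<equiv> prod_list (map x is)"

text \<open>
  Modulo \<open>conv x y\<close>, a product \<open>x\<^sub>i y\<^sub>j\<^sub>1 \<dots> y\<^sub>j\<^sub>q\<close> is a combination of such products
  of the same weight with \<open>i \<ge> q\<close>.  Replacing \<open>x\<^sub>q y\<^sub>j\<close> by the other terms of
  \<open>conv x y (q + j)\<close> either raises the index of \<open>x\<close> or raises \<open>j\<close>, which the weight bounds.
\<close>

lemma word_reduce:
  fixes x y :: "nat \<Rightarrow> 'a::comm_ring_1"
  assumes J: "is_ideal J"
    and "\<And>i js. q \<le> i \<Longrightarrow> length js = q \<Longrightarrow> i + sum_list js = w \<Longrightarrow> c * x i * word y js \<in> J"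
    and "\<And>m js. Suc (length js) = q \<Longrightarrow> m + sum_list js = w \<Longrightarrow> c * conv x y m * word y js \<in> J"
    and "length js = q" "i + sum_list js = w"
  shows "c * x i * word y js \<in> J"
  using assms(2-)
proof (induction q arbitrary: c w i js)
  case (Suc q)
  \<comment> \<open>With \<open>y j\<close> set aside as part of the constant, q letters remain and
    the outer induction raises the index of x to at least q. Only index exactly q then needs a
    relation.\<close>
  have claim: "c * y j * x i * word y js \<in> J"
    if "length js = q" "i + j + sum_list js = w" for i j js
    using that
  proof (induction "w - j" arbitrary: i j js rule: less_induct)
    case less
    have jw: "j \<le> w"
      using less.prems by simp
    show ?case
    proof (rule Suc.IH[of "w - j"])
      fix i' js' assume A: "q \<le> i'" "length js' = q" "i' + sum_list js' = w - j"
      show "c * y j * x i' * word y js' \<in> J"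
      proof (cases "i' = q")
        case False
        then show ?thesis
          using Suc.prems(1)[of i' "j # js'"] A jw by (simp add: mult_ac)
      next
        case True
        have "c * x k * y (q + j - k) * word y js' \<in> J" if k: "k \<le> q + j" "k \<noteq> q" for k
        proof (cases "k < q")
          case True
          have "w - (q + j - k) < w - j" "k + (q + j - k) + sum_list js' = w"
            using True A jw \<open>i' = q\<close> by auto
          then show ?thesis
            using less.hyps[of "q + j - k" js' k] A by (simp add: mult_ac)
        next
          case False
          then show ?thesis
            using Suc.prems(1)[of k "(q + j - k) # js'"] A jw k \<open>i' = q\<close> by (simp add: mult_ac)
        qed
        then have "(\<Sum>k\<in>{..q + j} - {q}. c * x k * y (q + j - k) * word y js') \<in> J"
          by (intro ideal_sum[OF J]) auto
        moreover have "c * conv x y (q + j) * word y js' \<in> J"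
          using Suc.prems(2)[of js' "q + j"] A jw \<open>i' = q\<close> by simp
        moreover have "c * conv x y (q + j) * word y js' =
            (\<Sum>k\<in>{..q + j} - {q}. c * x k * y (q + j - k) * word y js') + c * y j * x q * word y js'"
          unfolding conv_def by (subst sum.remove[of _ q])
            (auto simp: algebra_simps sum_distrib_left sum_distrib_right)
        ultimately show ?thesis
          using \<open>i' = q\<close> by (simp add: ideal_add_iff[OF J])
      qed
    next
      fix m js' assume "Suc (length js') = q" "m + sum_list js' = w - j"
      then show "c * y j * conv x y m * word y js' \<in> J"
        using Suc.prems(2)[of "j # js'" m] jw by (simp add: mult_ac)
    qed (use less.prems in auto)
  qed
  obtain j js' where "js = j # js'"
    using Suc.prems(3) by (cases js) auto
  then show ?case
    using claim[of js' i j] Suc.prems(3,4) by (simp add: mult_ac)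
qed auto

text \<open>Applying \<open>word_reduce\<close> to one letter of x after another leaves p letters of
  index at least q. Their weight is at least p * q > w, so no such word exists.\<close>

lemma word_mem:
  fixes x y :: "nat \<Rightarrow> 'a::comm_ring_1"
  assumes J: "is_ideal J" and w: "w < p * q"
    and rel: "\<And>m is js. Suc (length is) = p \<Longrightarrow> Suc (length js) = q \<Longrightarrow>
      m + sum_list is + sum_list js = w \<Longrightarrow> word x is * conv x y m * word y js \<in> J"
    and "length is = p" "length js = q" "sum_list is + sum_list js = w"
  shows "word x is * word y js \<in> J"
proof -
  have "word x us * word x vs * word y js \<in> J"
    if "length us + length vs = p" "\<forall>u\<in>set us. q \<le> u" "length js = q"
      "sum_list us + sum_list vs + sum_list js = w" for us vs js
    using that
  proof (induction vs arbitrary: us js)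
    case Nil
    have "length us * q \<le> sum_list us"
      using Nil(2) by (induction us) auto
    then show ?case
      using Nil w by simp
  next
    case (Cons v vs)
    have "word x us * word x vs * x v * word y js \<in> J"
    proof (rule word_reduce[OF J, where q = q and w = "w - sum_list us - sum_list vs"])
      fix i js' assume "q \<le> i" "length js' = q"
        "i + sum_list js' = w - sum_list us - sum_list vs"
      then show "word x us * word x vs * x i * word y js' \<in> J"
        using Cons.IH[of "i # us" js'] Cons.prems by (simp add: mult_ac)
    next
      fix m js' assume "Suc (length js') = q"
        "m + sum_list js' = w - sum_list us - sum_list vs"
      then show "word x us * word x vs * conv x y m * word y js' \<in> J"
        using rel[of "us @ vs" js' m] Cons.prems by (simp add: mult_ac)
    qed (use Cons.prems in auto)
    then show ?case
      by (simp add: mult_ac)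
  qed
  from this[of "[]" "is" js] show ?thesis
    using assms by simp
qed

text \<open>A coefficient \<open>conv x y m\<close> with m \<ge> N is not known to lie in J, but it
  uses up at least N of the weight and one letter of each word; induction handles what remains. In
  the hypothesis k counts such coefficients.\<close>

lemma word_mem_truncated:
  fixes x y :: "nat \<Rightarrow> 'a::comm_ring_1"
  assumes J: "is_ideal J" and N: "\<And>m. m < N \<Longrightarrow> conv x y m \<in> J"
    and "\<And>k. k \<le> p \<Longrightarrow> k \<le> q \<Longrightarrow> w < N * k + (p - k) * (q - k)"
    and "length is = p" "length js = q" "sum_list is + sum_list js = w"
  shows "word x is * word y js \<in> J"
  using assms(3-)
proof (induction p arbitrary: q w "is" js)
  case 0
  from 0(1)[of 0] show ?case by simp
next
  case (Suc p)
  show ?case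
  proof (cases q)
    case 0
    with Suc.prems(1)[of 0] show ?thesis by simp
  next
    case q: (Suc q')
    show ?thesis
    proof (rule word_mem[OF J, where p = "Suc p" and q = q and w = w])
      show "w < Suc p * q"
        using Suc.prems(1)[of 0] by simp
    next
      fix m us vs
      assume A: "Suc (length us) = Suc p" "Suc (length vs) = q"
        "m + sum_list us + sum_list vs = w"
      show "word x us * conv x y m * word y vs \<in> J"
      proof (cases "m < N")
        case True
        then show ?thesis
          by (intro ideal_mult_right[OF J] ideal_mult_left[OF J] N)
      next
        case False
        have "word x us * word y vs \<in> J"
        proof (rule Suc.IH[of q' "w - m"])
          fix k assume "k \<le> p" "k \<le> q'"
          then show "w - m < N * k + (p - k) * (q' - k)"
            using Suc.prems(1)[of "Suc k"] False q A by simp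
        qed (use A q in auto)
        from ideal_mult_left[OF J this, of "conv x y m"] show ?thesis
          by (simp add: mult_ac)
      qed
    qed (use Suc.prems in auto)
  qed
qed

text \<open>
  With \<open>p = c + b\<close> and \<open>q = c + a\<close> one has
  \<open>(a + b) k + (p - k) (q - k) = p q - c\<^sup>2 + (k - c)\<^sup>2\<close>, which is why this \<open>q\<close> is the right choice.
\<close>

lemma power_mult_power_mem:
  fixes x y :: "nat \<Rightarrow> 'a::comm_ring_1"
  assumes J: "is_ideal J" and N: "\<And>m. m < a + b \<Longrightarrow> conv x y m \<in> J"
    and "b \<le> p" "h * p + a * b < a * p"
  shows "\<exists>q. x h ^ p * y b ^ q \<in> J"
proof -
  define c where "c = p - b"
  have p: "p = c + b"
    using assms by (simp add: c_def)
  have "word x (replicate p h) * word y (replicate (c + a) b) \<in> J"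
  proof (rule word_mem_truncated[OF J N])
    fix k assume k: "k \<le> p" "k \<le> c + a"
    \<comment> \<open>With q = c + a, the assumption on p says precisely that the weight h * p + b *
      q of the word is below p * q - c^2, the value of the bound at k = c.\<close>
    have "int (h * p + b * (c + a)) < int c * int a + int b * int c + int a * int b"
      using assms(4) unfolding p of_nat_less_iff[where 'a = int, symmetric]
      by (simp add: algebra_simps)
    also have "\<dots> \<le> int c * int a + int b * int c + int a * int b + (int k - int c)\<^sup>2"
      by simp
    also have "\<dots> = int ((a + b) * k + (p - k) * (c + a - k))"
    proof -
      have "int (p - k) = int c + int b - int k" "int (c + a - k) = int c + int a - int k"
        using k by (auto simp: p)
      then show ?thesis
        unfolding of_nat_add of_nat_mult by (simp only:) (simp add: algebra_simps power2_eq_square)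
    qed
    finally show "h * p + b * (c + a) < (a + b) * k + (p - k) * (c + a - k)"
      by linarith
  qed (auto simp: sum_list_replicate)
  then show ?thesis
    by (auto simp: map_replicate)
qed

section \<open>Coefficients of a finite product of series\<close>

definition jet_coeff :: "('n::finite \<Rightarrow> nat \<Rightarrow> 'a::comm_ring_1) \<Rightarrow> nat \<Rightarrow> 'a" where
  "jet_coeff x m = fps_nth (\<Prod>i\<in>UNIV. Abs_fps (x i)) m"

lemma size_eq_sum_count: "size X = (\<Sum>i\<in>UNIV. count X i)" for X :: "'n::finite multiset"
  unfolding size_multiset_overloaded_eq
  by (rule sum.mono_neutral_left) (auto simp: not_in_iff)

lemma ex_multiset_count: "\<exists>X. count X = k" for k :: "'n::finite \<Rightarrow> nat"
  by (rule exI[of _ "Abs_multiset k"]) (simp add: count_Abs_multiset)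

lemma multisets_of_size_UNIV: "multisets_of_size UNIV m = {X. size X = m}"
  by (auto simp: multisets_of_size_def)

lemma finite_multisets_size: "finite {X :: 'n::finite multiset. size X = m}"
  using finite_multisets_of_size[of "UNIV :: 'n set" m] by (simp add: multisets_of_size_UNIV)

text \<open>A multiset X encodes an index vector: \<open>count X i\<close> is the power of t taken
  from the series i, and the size of X is the weight.\<close>

lemma jet_coeff_eq: "jet_coeff x m = (\<Sum>X | size X = m. \<Prod>i\<in>UNIV. x i (count X i))"
  unfolding jet_coeff_def by (simp add: fps_prod_nth' multisets_of_size_UNIV)

lemma jet_coeff_eq_conv:
  "jet_coeff x m = conv (x i) (fps_nth (\<Prod>j\<in>UNIV - {i}. Abs_fps (x j))) m"
  unfolding jet_coeff_def
  by (subst prod.remove[of _ i]) (auto simp: fps_mult_nth conv_def atLeast0AtMost)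

text \<open>
  For two distinct exponent vectors of the same weight, the product of their monomials is divisible
  by a monomial of smaller weight; so the square of one monomial of weight \<open>m\<close> is congruent
  to its product with \<open>jet_coeff x m\<close>.
\<close>

lemma prod_mem_radical_ideal:
  fixes x :: "'n::finite \<Rightarrow> nat \<Rightarrow> 'a::comm_ring_1"
  assumes J: "is_ideal J" and rad: "\<And>z k. z ^ k \<in> J \<Longrightarrow> z \<in> J"
    and N: "\<And>m. m < N \<Longrightarrow> jet_coeff x m \<in> J"
    and k: "(\<Sum>i\<in>UNIV. k i) < N"
  shows "(\<Prod>i\<in>UNIV. x i (k i)) \<in> J"
  using k
proof (induction "\<Sum>i\<in>UNIV. k i" arbitrary: k rule: less_induct)
  case less
  define u where "u l = (\<Prod>i\<in>UNIV. x i (l i))" for l :: "'n \<Rightarrow> nat"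
  define m where "m = (\<Sum>i\<in>UNIV. k i)"
  obtain K where K: "count K = k"
    using ex_multiset_count by blast
  have Km: "size K = m"
    by (simp add: size_eq_sum_count K m_def)
  have "u k * u (count X) \<in> J" if X: "size X = m" "X \<noteq> K" for X
  proof -
    have "\<exists>i. k i < count X i"
    proof (rule ccontr)
      assume "\<not> ?thesis"
      then have "X \<subseteq># K"
        by (auto simp: subseteq_mset_def K not_less)
      then show False
        using X Km mset_subset_size[of X K] by (auto simp: subset_mset_def)
    qed
    then obtain i where i: "k i < count X i" ..
    define l where "l = (count X)(i := k i)"
    have "(\<Sum>i\<in>UNIV. l i) < (\<Sum>i\<in>UNIV. count X i)"
      using i by (intro sum_strict_mono_ex1) (auto simp: l_def)
    then have "(\<Sum>i\<in>UNIV. l i) < m"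
      using X by (simp add: size_eq_sum_count)
    then have "u l \<in> J"
      using less unfolding u_def m_def by simp
    moreover have "u l dvd u k * u (count X)"
    proof -
      have "u l = x i (k i) * (\<Prod>j\<in>UNIV - {i}. x j (count X j))"
        unfolding u_def by (subst prod.remove[of _ i]) (auto simp: l_def)
      moreover have "x i (k i) dvd u k"
        unfolding u_def by (rule dvd_prodI) auto
      moreover have "(\<Prod>j\<in>UNIV - {i}. x j (count X j)) dvd u (count X)"
        unfolding u_def by (rule prod_dvd_prod_subset) auto
      ultimately show ?thesis
        by (simp add: mult_dvd_mono)
    qed
    ultimately show ?thesis
      by (rule ideal_dvd[OF J])
  qed
  then have "(\<Sum>X\<in>{X. size X = m} - {K}. u k * u (count X)) \<in> J"
    by (intro ideal_sum[OF J]) auto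
  moreover have "u k * jet_coeff x m \<in> J"
    using less.prems by (intro ideal_mult_left[OF J] N) (simp add: m_def)
  moreover have "u k * jet_coeff x m =
      (\<Sum>X\<in>{X. size X = m} - {K}. u k * u (count X)) + u k * u k"
    unfolding jet_coeff_eq u_def[symmetric]
    by (subst sum.remove[of _ K])
      (use finite_multisets_size Km in \<open>auto simp: K algebra_simps sum_distrib_left\<close>)
  ultimately have "u k ^ 2 \<in> J"
    by (simp add: ideal_add_iff[OF J] power2_eq_square)
  then show ?case
    unfolding u_def by (rule rad)
qed

section \<open>The nilpotency bound over an arbitrary ring\<close>

text \<open>
  Localising at \<open>u\<close>, the product of the \<open>x\<^sub>j\<close> with index \<open>a j\<close>, makes all \<open>x\<^sub>j\<close> of index below
  \<open>a j\<close> nilpotent, so that the coefficient of \<open>t\<^sup>b\<close> in the product of the series other than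
  the \<open>i\<close>-th is invertible and \<open>power_mult_power_mem\<close> applies.
\<close>

lemma power_mem_saturation:
  fixes x :: "'n::finite \<Rightarrow> nat \<Rightarrow> 'a::comm_ring_1" and X :: "'n multiset"
  assumes I: "is_ideal I" and N: "\<And>m. m < size X \<Longrightarrow> jet_coeff x m \<in> I"
    and b: "size X = count X i + b" "b \<le> p" "h * p + count X i * b < count X i * p"
  shows "\<exists>k. x i h ^ p * (\<Prod>j\<in>UNIV. x j (count X j)) ^ k \<in> I"
proof -
  define u where "u = (\<Prod>j\<in>UNIV. x j (count X j))"
  define u' where "u' = (\<Prod>j\<in>UNIV - {i}. x j (count X j))"
  define y where "y = fps_nth (\<Prod>j\<in>UNIV - {i}. Abs_fps (x j))"
  \<comment> \<open>K consists of the elements that vanish modulo I after inverting u, and R of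
    those that become nilpotent there.\<close>
  define K where "K = {z. \<exists>k. z * u ^ k \<in> I}"
  define R where "R = {z. \<exists>k. z ^ k \<in> K}"
  have K: "is_ideal K"
    unfolding K_def by (rule ideal_saturation[OF I])
  have R: "is_ideal R"
    unfolding R_def by (rule ideal_radical[OF K])
  have IK: "z \<in> K" if "z \<in> I" for z
    using that unfolding K_def by (auto intro: exI[of _ 0])
  \<comment> \<open>Lowering the index at j to k lowers the weight, so the new product is nilpotent
    modulo I. Its other factors divide u and hence are invertible where u is.\<close>
  have "x j k \<in> R" if k: "k < count X j" for j k
  proof -
    let ?I' = "{z. \<exists>k. z ^ k \<in> I}"
    define l where "l = (count X)(j := k)"
    have "(\<Prod>i\<in>UNIV. x i (l i)) \<in> ?I'"
    proof (rule prod_mem_radical_ideal[where N = "size X"])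
      show "is_ideal ?I'"
        by (rule ideal_radical[OF I])
      show "z \<in> ?I'" if "z ^ k \<in> ?I'" for z k
        using that by (auto simp flip: power_mult)
      show "jet_coeff x m \<in> ?I'" if "m < size X" for m
        using N[OF that] by (auto intro: exI[of _ 1])
      show "(\<Sum>i\<in>UNIV. l i) < size X"
        unfolding size_eq_sum_count using k
        by (intro sum_strict_mono_ex1) (auto simp: l_def)
    qed
    then obtain m where m: "(\<Prod>i\<in>UNIV. x i (l i)) ^ m \<in> I"
      by auto
    have "(\<Prod>i\<in>UNIV. x i (l i)) = x j k * (\<Prod>i\<in>UNIV - {j}. x i (count X i))"
      by (subst prod.remove[of _ j]) (auto simp: l_def)
    moreover have "u = x j (count X j) * (\<Prod>i\<in>UNIV - {j}. x i (count X i))"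
      unfolding u_def by (subst prod.remove[of _ j]) auto
    ultimately have "x j k ^ m * u ^ m = (\<Prod>i\<in>UNIV. x i (l i)) ^ m * x j (count X j) ^ m"
      by (simp add: power_mult_distrib mult_ac)
    also have "\<dots> \<in> I"
      by (rule ideal_mult_right[OF I m])
    finally show ?thesis
      by (auto simp: R_def K_def)
  qed
  note xR = this
  obtain q where "x i h ^ p * y b ^ q \<in> I"
  proof -
    have "\<exists>q. x i h ^ p * y b ^ q \<in> I"
    proof (rule power_mult_power_mem[OF I _ b(2,3)])
      fix m assume "m < count X i + b"
      then show "conv (x i) y m \<in> I"
        using N[of m] b(1) unfolding y_def jet_coeff_eq_conv[of x m i] by simp
    qed
    then show ?thesis
      using that by blast
  qed
  then have q: "y b ^ q \<in> {z. z * x i h ^ p \<in> K}"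
    by (simp add: mult.commute IK)
  \<comment> \<open>Any other index vector of weight b off i has an entry below that of X, so its
    monomial is nilpotent by the previous step; only u' survives in \<open>y b\<close>.\<close>
  have "u' - y b \<in> R"
  proof -
    define Y where "Y = filter_mset (\<lambda>j. j \<noteq> i) X"
    have "X = Y + replicate_mset (count X i) i"
      by (rule multiset_eqI) (auto simp: Y_def)
    then have "size X = size Y + count X i"
      by (metis size_replicate_mset size_union)
    then have Yb: "size Y = b"
      using b(1) by simp
    have Ym: "Y \<in> multisets_of_size (UNIV - {i}) b"
      using Yb by (auto simp: multisets_of_size_def Y_def)
    have "y b = (\<Sum>Z\<in>multisets_of_size (UNIV - {i}) b. \<Prod>j\<in>UNIV - {i}. x j (count Z j))"
      unfolding y_def by (simp add: fps_prod_nth')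
    also have "\<dots> = (\<Prod>j\<in>UNIV - {i}. x j (count Y j)) +
        (\<Sum>Z\<in>multisets_of_size (UNIV - {i}) b - {Y}. \<Prod>j\<in>UNIV - {i}. x j (count Z j))"
      using Ym by (intro sum.remove finite_multisets_of_size) auto
    also have "(\<Prod>j\<in>UNIV - {i}. x j (count Y j)) = u'"
      unfolding u'_def by (rule prod.cong) (auto simp: Y_def)
    finally have eq: "u' - y b =
        - (\<Sum>Z\<in>multisets_of_size (UNIV - {i}) b - {Y}. \<Prod>j\<in>UNIV - {i}. x j (count Z j))"
      by simp
    show ?thesis
      unfolding eq
    proof (intro ideal_uminus[OF R] ideal_sum[OF R])
      fix Z assume "Z \<in> multisets_of_size (UNIV - {i}) b - {Y}"
      then have Z: "i \<notin># Z" "size Z = b" "Z \<noteq> Y"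
        by (auto simp: multisets_of_size_def)
      have "\<exists>j. count Z j < count Y j"
      proof (rule ccontr)
        assume "\<not> ?thesis"
        then have "Y \<subseteq># Z"
          by (auto simp: subseteq_mset_def not_less)
        then show False
          using Z Yb mset_subset_size[of Y Z] by (auto simp: subset_mset_def)
      qed
      then obtain j where "count Z j < count Y j" ..
      then have j: "j \<noteq> i" "count Z j < count X j"
        by (auto simp: Y_def split: if_splits)
      then have "x j (count Z j) dvd (\<Prod>j\<in>UNIV - {i}. x j (count Z j))"
        by (intro dvd_prodI) auto
      with xR[OF j(2)] show "(\<Prod>j\<in>UNIV - {i}. x j (count Z j)) \<in> R"
        by (rule ideal_dvd[OF R])
    qed
  qed
  then obtain r where "(u' - y b) ^ r \<in> K"
    by (auto simp: R_def)
  then have "(u' - y b) ^ r \<in> {z. z * x i h ^ p \<in> K}"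
    by (simp add: ideal_mult_right[OF K])
  \<comment> \<open>Powers of \<open>y b\<close> and of \<open>u' - y b\<close> both annihilate
    \<open>x i h ^ p\<close> modulo K, hence so does a power of their sum u', which divides
    u.\<close>
  from ideal_radical_add[OF ideal_colon[OF K] q this]
  have "u' ^ (q + r) * x i h ^ p \<in> K"
    by simp
  then have "x i (count X i) ^ (q + r) * (u' ^ (q + r) * x i h ^ p) \<in> K"
    by (rule ideal_mult_left[OF K])
  moreover have "u = x i (count X i) * u'"
    unfolding u_def u'_def by (subst prod.remove[of _ i]) auto
  ultimately have "x i h ^ p * u ^ (q + r) \<in> K"
    by (simp add: power_mult_distrib mult_ac)
  then obtain k where "x i h ^ p * u ^ (q + r) * u ^ k \<in> I"
    by (auto simp: K_def)
  then show ?thesis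
    by (auto simp: u_def mult.assoc simp flip: power_add)
qed

text \<open>This turns the threshold on p into the hypotheses of \<open>power_mem_saturation\<close>
  for every split a + b = H + 1 with a > h. The extreme split a = h + 1 requires exactly p > (h + 1)
  * (H - h).\<close>

lemma exponent_bound:
  fixes a b h p H :: nat
  assumes "h < a" "a + b = Suc H" "(h + 1) * (H - h) < p"
  shows "b \<le> p" "h * p + a * b < a * p"
proof -
  obtain e where a: "a = h + 1 + e"
    using assms(1) by (metis Suc_eq_plus1 less_eq_Suc_le le_Suc_ex)
  then have H: "H - h = e + b"
    using assms(2) by simp
  have p: "Suc ((h + 1) * (e + b)) \<le> p"
    using assms(3) H by simp
  have "e + b \<le> (h + 1) * (e + b)"
    by simp
  then show "b \<le> p"
    using p by linarith
  have "a * b \<le> (1 + e) * ((h + 1) * (e + b))"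
    by (simp add: a algebra_simps)
  also have "\<dots> < (1 + e) * p"
    using p by (intro mult_strict_left_mono) auto
  finally show "h * p + a * b < a * p"
    by (simp add: a algebra_simps)
qed

lemma prod_power_mem:
  fixes x :: "'n::finite \<Rightarrow> nat \<Rightarrow> 'a::comm_ring_1" and h :: "'n \<Rightarrow> nat"
  defines "H \<equiv> \<Sum>i\<in>UNIV. h i"
  assumes reg: "nzd (jet_coeff x ` {..H}) (jet_coeff x (Suc H))"
    and p: "\<And>i. (h i + 1) * (H - h i) < p"
  shows "(\<Prod>i\<in>UNIV. x i (h i)) ^ p \<in> ideal_gen (jet_coeff x ` {..H})"
proof -
  define I where "I = ideal_gen (jet_coeff x ` {..H})"
  define M where "M = (\<Prod>i\<in>UNIV. x i (h i)) ^ p"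
  have I: "is_ideal I"
    by (simp add: I_def)
  \<comment> \<open>Since \<open>jet_coeff x (Suc H)\<close> is a nonzerodivisor modulo I, it is
    enough that one of its powers lies in C. The radical of C is an ideal, so each term can be
    treated separately.\<close>
  define C where "C = {z. z * M \<in> I}"
  have C: "is_ideal C"
    unfolding C_def by (rule ideal_colon[OF I])
  have "(\<Prod>j\<in>UNIV. x j (count X j)) \<in> {z. \<exists>k. z ^ k \<in> C}" if X: "size X = Suc H" for X
  proof -
    have "\<exists>i. h i < count X i"
    proof (rule ccontr)
      assume "\<not> ?thesis"
      then have "size X \<le> H"
        unfolding size_eq_sum_count H_def by (intro sum_mono) (auto simp: not_less)
      then show False
        using X by simp
    qed
    then obtain i where i: "h i < count X i" ..
    obtain b where b: "size X = count X i + b"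
      using count_le_size[of X i] le_Suc_ex by blast
    have "\<exists>k. x i (h i) ^ p * (\<Prod>j\<in>UNIV. x j (count X j)) ^ k \<in> I"
    proof (rule power_mem_saturation[OF I _ b])
      show "b \<le> p" "h i * p + count X i * b < count X i * p"
        by (rule exponent_bound[OF i _ p]; use b X in simp)+
    qed (auto simp: X I_def intro!: ideal_gen_base)
    then obtain k where "x i (h i) ^ p * (\<Prod>j\<in>UNIV. x j (count X j)) ^ k \<in> I" ..
    moreover have "x i (h i) ^ p dvd M"
      unfolding M_def by (intro dvd_power_same dvd_prodI) auto
    ultimately have "M * (\<Prod>j\<in>UNIV. x j (count X j)) ^ k \<in> I"
      by (rule ideal_dvd[OF I _ mult_dvd_mono]) simp
    then show ?thesis
      by (auto simp: C_def mult.commute)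
  qed
  then have "jet_coeff x (Suc H) \<in> {z. \<exists>k. z ^ k \<in> C}"
    unfolding jet_coeff_eq by (intro ideal_sum[OF ideal_radical[OF C]]) auto
  then obtain k where "M * jet_coeff x (Suc H) ^ k \<in> I"
    by (auto simp: C_def mult.commute)
  then show ?thesis
    using nzdD[OF nzd_power[OF reg]] by (simp add: M_def I_def)
qed

section \<open>The jets of the product form a regular sequence\<close>

text \<open>Modulo its constant term the series i is t times its shift, and this factor t lowers the
  index of the coefficient by one.\<close>

lemma jet_coeff_Suc_shift:
  fixes x :: "'n::finite \<Rightarrow> nat \<Rightarrow> 'a::comm_ring_1"
  shows "jet_coeff x (Suc m) - jet_coeff (x(i := \<lambda>j. x i (Suc j))) m \<in> ideal_gen (insert (x i 0) S)"
proof -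
  define y where "y = fps_nth (\<Prod>j\<in>UNIV - {i}. Abs_fps (x j))"
  have y': "y = fps_nth (\<Prod>j\<in>UNIV - {i}. Abs_fps ((x(i := \<lambda>j. x i (Suc j))) j))"
    unfolding y_def by (intro arg_cong[of _ _ fps_nth] prod.cong) auto
  have "jet_coeff x (Suc m) = x i 0 * y (Suc m) + conv (\<lambda>j. x i (Suc j)) y m"
    unfolding jet_coeff_eq_conv[of x _ i] y_def[symmetric] conv_def
    by (simp add: sum.atMost_Suc_shift del: sum.atMost_Suc)
  moreover have "jet_coeff (x(i := \<lambda>j. x i (Suc j))) m = conv (\<lambda>j. x i (Suc j)) y m"
    unfolding jet_coeff_eq_conv[of _ _ i] y'[symmetric] by simp
  ultimately show ?thesis
    by (simp add: ideal_mult_right[OF is_ideal_ideal_gen] ideal_gen_base)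
qed

section \<open>Divided variables \<open>jvar\<close> and the ideals they generate\<close>

definition jvar :: "'n \<Rightarrow> nat \<Rightarrow> ('k::field_char_0, 'n) dpoly" where
  "jvar i j = dconst (inverse (fact j)) * dvar i j"

lemma jvar_eq_single:
  "jvar i j = Poly_Mapping.single (Poly_Mapping.single (i, j) 1) (inverse (fact j))"
  by (simp add: jvar_def dconst_def dvar_def mult_single)

lemma lookup_mult_single:
  fixes P :: "'n dmonom \<Rightarrow>\<^sub>0 'k::comm_ring_1"
  shows "Poly_Mapping.lookup (P * Poly_Mapping.single v c) (m + v) = Poly_Mapping.lookup P m * c"
  by (induction P rule: dpoly_induct)
    (auto simp: mult_single lookup_single lookup_add distrib_right when_def)

lemma mem_ideal_gen_jvar_iff:
  fixes P :: "('k::field_char_0, 'n) dpoly"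
  shows "P \<in> ideal_gen {jvar i j | i j. (i, j) \<in> S} \<longleftrightarrow>
    (\<forall>m. Poly_Mapping.lookup P m \<noteq> 0 \<longrightarrow> (\<exists>v\<in>S. Poly_Mapping.lookup m v \<noteq> 0))"
    (is "P \<in> ?I \<longleftrightarrow> ?Q")
proof -
  define Q :: "('k, 'n) dpoly set" where
    "Q = {P. \<forall>m. Poly_Mapping.lookup P m \<noteq> 0 \<longrightarrow> (\<exists>v\<in>S. Poly_Mapping.lookup m v \<noteq> 0)}"
  have "?I \<subseteq> Q"
  proof (rule ideal_gen_least)
    show "is_ideal Q"
    proof (rule is_idealI)
      fix a b :: "('k, 'n) dpoly" assume "a \<in> Q" "b \<in> Q"
      then show "a + b \<in> Q"
        unfolding Q_def by (auto simp: lookup_add) (metis add.right_neutral)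
    next
      fix r a :: "('k, 'n) dpoly" assume a: "a \<in> Q"
      show "r * a \<in> Q"
        unfolding Q_def
      proof (intro CollectI allI impI)
        fix m assume "Poly_Mapping.lookup (r * a) m \<noteq> 0"
        then have "m \<in> Poly_Mapping.keys (r * a)"
          by (simp add: in_keys_iff)
        then obtain m1 m2 where m: "m = m1 + m2" "m2 \<in> Poly_Mapping.keys a"
          using keys_mult[of r a] by blast
        then obtain v where "v \<in> S" "Poly_Mapping.lookup m2 v \<noteq> 0"
          using a by (auto simp: in_keys_iff Q_def)
        then show "\<exists>v\<in>S. Poly_Mapping.lookup m v \<noteq> 0"
          using m by (auto simp: lookup_add)
      qed
    qed (auto simp: Q_def)
  qed (auto simp: Q_def jvar_eq_single lookup_single when_def split: if_splits)
  moreover have "P \<in> ?I" if P: "P \<in> Q"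
  proof -
    have "Poly_Mapping.single m (Poly_Mapping.lookup P m) \<in> ?I" if m: "m \<in> Poly_Mapping.keys P" for m
  proof -
    obtain i j where v: "(i, j) \<in> S" "Poly_Mapping.lookup m (i, j) \<noteq> 0"
      using P m by (auto simp: in_keys_iff Q_def)
    have "m = m - Poly_Mapping.single (i, j) 1 + Poly_Mapping.single (i, j) 1"
      by (rule poly_mapping_eqI)
        (use v(2) in \<open>auto simp: lookup_add lookup_minus lookup_single when_def\<close>)
    then have "Poly_Mapping.single m (Poly_Mapping.lookup P m) =
        Poly_Mapping.single (m - Poly_Mapping.single (i, j) 1) (Poly_Mapping.lookup P m * fact j) *
        jvar i j"
      by (simp add: jvar_eq_single mult_single mult.assoc)
    also have "\<dots> \<in> ?I"
      using v(1) by (intro ideal_mult_left ideal_gen_base) auto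
    finally show ?thesis .
  qed
  then show ?thesis
    by (subst poly_mapping_sum_single) (rule ideal_sum[OF is_ideal_ideal_gen])
  qed
  ultimately have "P \<in> ?I \<longleftrightarrow> P \<in> Q"
    by blast
  then show ?thesis
    by (simp add: Q_def)
qed

text \<open>Multiplication by a variable outside S shifts the monomials injectively and does not
  change which variables of S occur in them.\<close>

lemma nzd_jvar:
  assumes "(i, j) \<notin> S"
  shows "nzd {jvar i j :: ('k::field_char_0, 'n) dpoly | i j. (i, j) \<in> S} (jvar i j)"
  unfolding nzd_def mem_ideal_gen_jvar_iff
proof (intro allI impI)
  fix P :: "('k, 'n) dpoly" and m
  let ?v = "Poly_Mapping.single (i, j) 1 :: 'n dmonom"
  assume A: "\<forall>m. Poly_Mapping.lookup (P * jvar i j) m \<noteq> 0 \<longrightarrow> (\<exists>v\<in>S. Poly_Mapping.lookup m v \<noteq> 0)"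
    and m: "Poly_Mapping.lookup P m \<noteq> 0"
  have "Poly_Mapping.lookup (P * jvar i j) (m + ?v) \<noteq> 0"
    unfolding jvar_eq_single lookup_mult_single using m by simp
  then obtain v where "v \<in> S" "Poly_Mapping.lookup (m + ?v) v \<noteq> 0"
    using A by blast
  then show "\<exists>v\<in>S. Poly_Mapping.lookup m v \<noteq> 0"
    using assms by (auto simp: lookup_add lookup_single when_def split: if_splits)
qed

text \<open>
  The first generator is the product of the \<open>x\<^sub>i = jvar i (e i)\<close>, and modulo any one of them
  the remaining generators become those of the shifted problem.
\<close>

lemma regular_seq_jet_coeff:
  fixes e :: "'n::finite \<Rightarrow> nat"
  shows "regular_seq {jvar i j :: ('k::field_char_0, 'n) dpoly | i j. j < e i}
    (map (jet_coeff (\<lambda>i j. jvar i (e i + j))) [0..<m])"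
proof (induction m arbitrary: e)
  case (Suc m)
  let ?V = "\<lambda>e. {jvar i j :: ('k, 'n) dpoly | i j. j < e i}"
  let ?x = "\<lambda>e i j. jvar i (e i + j) :: ('k, 'n) dpoly"
  have nzd: "nzd (?V e) (jvar i (e i))" for i
    using nzd_jvar[of i "e i" "{(i, j). j < e i}"] by simp
  have G0: "jet_coeff (?x e) 0 = (\<Prod>i\<in>UNIV. jvar i (e i))"
    by (simp add: jet_coeff_eq)
  have "regular_seq (insert (\<Prod>i\<in>UNIV. jvar i (e i)) (?V e)) (map (\<lambda>k. jet_coeff (?x e) (Suc k)) [0..<m])"
  proof (rule regular_seq_insert_prod)
    fix i
    \<comment> \<open>The vector e records how many leading coefficients of each series have been
      set to zero; adjoining \<open>jvar i (e i)\<close> raises its entry at i.\<close>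
    let ?e = "e(i := Suc (e i))"
    have V: "insert (jvar i (e i)) (?V e) = ?V ?e"
      by (auto simp: less_Suc_eq)
    have x: "?x ?e = (?x e)(i := \<lambda>j. ?x e i (Suc j))"
      by (auto simp: fun_eq_iff)
    have "list_all2 (\<lambda>a b. a - b \<in> ideal_gen (insert (jvar i (e i)) (?V e)))
        (map (\<lambda>k. jet_coeff (?x e) (Suc k)) [0..<m]) (map (jet_coeff (?x ?e)) [0..<m])"
      unfolding x using jet_coeff_Suc_shift[of "?x e" _ i "?V e"]
      by (simp add: list_all2_map1 list_all2_map2 list.rel_refl_strong)
    then show "regular_seq (insert (jvar i (e i)) (?V e)) (map (\<lambda>k. jet_coeff (?x e) (Suc k)) [0..<m])"
      using Suc[of ?e] by (subst regular_seq_cong) (simp_all only: V)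
  qed (use nzd in auto)
  moreover have "map (jet_coeff (?x e)) [0..<Suc m] =
      jet_coeff (?x e) 0 # map (\<lambda>k. jet_coeff (?x e) (Suc k)) [0..<m]"
    by (simp add: upt_conv_Cons map_Suc_upt[symmetric] comp_def del: upt_Suc)
  ultimately show ?case
    by (simp add: G0 nzd nzd_prod)
qed simp

lemma nzd_jet_coeff_jvar:
  "nzd (jet_coeff jvar ` {..<m}) (jet_coeff jvar m :: ('k::field_char_0, 'n::finite) dpoly)"
  using regular_seq_jet_coeff[where 'k = 'k and 'n = 'n and e = "\<lambda>_. 0" and m = "Suc m"]
  by (simp add: regular_seq_append atLeast0LessThan)

section \<open>Taylor coefficients and derivatives\<close>

lemma derivation_of_nat: "derivation D \<Longrightarrow> D (of_nat n) = 0"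
  by (induction n) (simp_all add: derivation_0 derivation_1 derivation_add)

lemma derivation_of_nat_mult: "derivation D \<Longrightarrow> D (of_nat n * z) = of_nat n * D z"
  by (simp add: derivation_mult derivation_of_nat)

text \<open>Applying D to the coefficients and differentiating in t are both derivations on power
  series. They agree on each factor, hence on the product.\<close>

lemma derivation_jet_coeff:
  fixes x :: "'n::finite \<Rightarrow> nat \<Rightarrow> 'a::comm_ring_1"
  assumes D: "derivation D" and x: "\<And>i j. D (x i j) = of_nat (Suc j) * x i (Suc j)"
  shows "D (jet_coeff x m) = of_nat (Suc m) * jet_coeff x (Suc m)"
proof -
  define E where "E f = Abs_fps (\<lambda>n. D (fps_nth f n))" for f
  have E_mult: "E (f * g) = E f * g + f * E g" for f g
    by (simp add: E_def fps_eq_iff fps_mult_nth derivation_sum[OF D] derivation_mult[OF D]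
        sum.distrib)
  have "E (\<Prod>i\<in>A. Abs_fps (x i)) = fps_deriv (\<Prod>i\<in>A. Abs_fps (x i))" for A :: "'n set"
  proof (induction A rule: infinite_finite_induct)
    case (insert i A)
    have "E (Abs_fps (x i)) = fps_deriv (Abs_fps (x i))"
      by (simp add: E_def fps_eq_iff x)
    with insert show ?case
      by (simp add: E_mult mult.commute add.commute)
  qed (simp_all add: E_def fps_eq_iff derivation_0[OF D] derivation_1[OF D])
  from arg_cong[OF this[of UNIV], of "\<lambda>f. fps_nth f m"] show ?thesis
    by (simp add: E_def jet_coeff_def)
qed

lemma derivation_funpow_jet_coeff:
  fixes x :: "'n::finite \<Rightarrow> nat \<Rightarrow> 'a::comm_ring_1"
  assumes D: "derivation D" and x: "\<And>i j. D (x i j) = of_nat (Suc j) * x i (Suc j)"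
  shows "(D ^^ m) (jet_coeff x 0) = of_nat (fact m) * jet_coeff x m"
  by (induction m)
    (simp_all add: derivation_of_nat_mult[OF D] derivation_jet_coeff[OF assms] algebra_simps
      del: of_nat_fact)

lemma dconst_add: "dconst (a + b) = dconst a + dconst b"
  and dconst_mult: "dconst (a * b) = dconst a * dconst b"
  and dconst_1: "dconst 1 = 1"
  by (simp_all add: dconst_def single_add mult_single)

lemma dconst_of_nat: "dconst (of_nat n) = of_nat n"
  by (induction n) (simp_all add: dconst_add dconst_1, simp add: dconst_def)

lemma dconst_prod: "dconst (prod f A) = (\<Prod>i\<in>A. dconst (f i))"
  by (induction A rule: infinite_finite_induct) (simp_all add: dconst_1 dconst_mult)

lemma dvar_eq_jvar: "dvar i j = dconst (fact j) * jvar i j"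
  by (simp add: jvar_def mult.assoc[symmetric] dconst_mult[symmetric] dconst_1)

lemma derivation_inverse_fact:
  fixes \<delta> :: "'k::field_char_0 \<Rightarrow> 'k"
  assumes "derivation \<delta>"
  shows "\<delta> (inverse (fact j)) = 0"
  using derivation_of_nat_mult[OF assms, of "fact j" "inverse (fact j)"] derivation_1[OF assms]
  by simp

lemma dderiv_jvar:
  assumes "derivation \<delta>"
  shows "dderiv \<delta> (jvar i j) = of_nat (Suc j) * jvar i (Suc j)"
proof -
  have "dderiv \<delta> (jvar i j) = dconst (inverse (fact j)) * dvar i (Suc j)"
    unfolding jvar_def derivation_mult[OF derivation_dderiv[OF assms]]
      dderiv_dconst[OF assms] derivation_inverse_fact[OF assms] dderiv_dvar[OF assms]
    by (simp add: dconst_def)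
  also have "inverse (fact j) = of_nat (Suc j) * inverse (fact (Suc j) :: 'a)"
    by (simp add: field_simps del: of_nat_Suc)
  finally show ?thesis
    by (simp add: jvar_def dconst_mult dconst_of_nat mult.assoc del: of_nat_Suc fact_Suc)
qed

text \<open>The m-th derivative of the product is m! times the m-th coefficient, and m! is a unit.
  The bound \<open>int N - 1\<close> includes the zero ideal at N = 0.\<close>

lemma I_ideal_eq:
  assumes "derivation \<delta>"
  shows "(I_ideal \<delta> (int N - 1) :: ('k::field_char_0, 'n::finite) dpoly set) =
    ideal_gen (jet_coeff jvar ` {..<N})"
proof -
  let ?D = "dderiv \<delta> :: ('k, 'n) dpoly \<Rightarrow> _"
  let ?F = "\<lambda>m. (?D ^^ m) (\<Prod>i\<in>UNIV. dvar i 0)"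
  have "(\<Prod>i\<in>UNIV. dvar i 0) = (jet_coeff jvar 0 :: ('k, 'n) dpoly)"
    by (simp add: jet_coeff_eq dvar_eq_jvar dconst_1)
  then have F: "?F m = of_nat (fact m) * jet_coeff jvar m" for m
    by (simp only:) (intro derivation_funpow_jet_coeff derivation_dderiv dderiv_jvar assms)
  have G: "jet_coeff jvar m = dconst (inverse (fact m)) * ?F m" for m
    unfolding F dconst_of_nat[symmetric] mult.assoc[symmetric] dconst_mult[symmetric]
    by (simp add: dconst_1)
  have "{?F m | m. int m \<le> int N - 1} = ?F ` {..<N}"
    by auto
  moreover have "ideal_gen (?F ` {..<N}) = ideal_gen (jet_coeff jvar ` {..<N})"
  proof (rule ideal_gen_eqI)
    show "?F ` {..<N} \<subseteq> ideal_gen (jet_coeff jvar ` {..<N})"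
      unfolding F by (auto intro: ideal_mult_left[OF is_ideal_ideal_gen] ideal_gen_base)
    show "jet_coeff jvar ` {..<N} \<subseteq> ideal_gen (?F ` {..<N})"
    proof safe
      fix m assume "m < N"
      then show "jet_coeff jvar m \<in> ideal_gen (?F ` {..<N})"
        by (subst G) (auto intro: ideal_mult_left[OF is_ideal_ideal_gen] ideal_gen_base)
    qed
  qed
  ultimately show ?thesis
    by (simp add: I_ideal_def)
qed

section \<open>Evaluation homomorphisms\<close>

definition is_hom :: "('a::comm_ring_1 \<Rightarrow> 'b::comm_ring_1) \<Rightarrow> bool" where
  "is_hom \<phi> \<longleftrightarrow> \<phi> 1 = 1 \<and> (\<forall>a b. \<phi> (a + b) = \<phi> a + \<phi> b) \<and> (\<forall>a b. \<phi> (a * b) = \<phi> a * \<phi> b)"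

context
  fixes \<phi> :: "'a::comm_ring_1 \<Rightarrow> 'b::comm_ring_1"
  assumes hom: "is_hom \<phi>"
begin

lemma hom_1: "\<phi> 1 = 1"
  and hom_add: "\<phi> (a + b) = \<phi> a + \<phi> b"
  and hom_mult: "\<phi> (a * b) = \<phi> a * \<phi> b"
  using hom by (auto simp: is_hom_def)

lemma hom_0: "\<phi> 0 = 0"
  using hom_add[of 0 0] by simp

lemma hom_sum: "\<phi> (sum f A) = (\<Sum>x\<in>A. \<phi> (f x))"
  by (induction A rule: infinite_finite_induct) (auto simp: hom_0 hom_add)

lemma hom_prod: "\<phi> (prod f A) = (\<Prod>x\<in>A. \<phi> (f x))"
  by (induction A rule: infinite_finite_induct) (auto simp: hom_1 hom_mult)

lemma hom_power: "\<phi> (a ^ n) = \<phi> a ^ n"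
  by (induction n) (auto simp: hom_1 hom_mult)

lemma hom_jet_coeff: "\<phi> (jet_coeff x m) = jet_coeff (\<lambda>i j. \<phi> (x i j)) m"
  by (simp add: jet_coeff_eq hom_sum hom_prod)

lemma hom_ideal_gen:
  assumes "is_ideal J" "\<And>a. a \<in> S \<Longrightarrow> \<phi> a \<in> J" "a \<in> ideal_gen S"
  shows "\<phi> a \<in> J"
proof -
  have "is_ideal {a. \<phi> a \<in> J}"
    using assms(1) by (intro is_idealI) (auto simp: hom_0 hom_add hom_mult is_ideal_def)
  then show ?thesis
    using ideal_gen_least[of S "{a. \<phi> a \<in> J}"] assms(2,3) by auto
qed

end

text \<open>The universal property of the polynomial ring. The base map \<open>\<kappa>\<close> will
  be the identity for the first claim and the inclusion of constants for sharpness.\<close>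

lemma ex_dpoly_hom:
  fixes \<kappa> :: "'k::comm_ring_1 \<Rightarrow> 'b::comm_ring_1" and v :: "'n \<Rightarrow> nat \<Rightarrow> 'b"
  assumes \<kappa>: "is_hom \<kappa>"
  obtains \<phi> :: "('k, 'n) dpoly \<Rightarrow> 'b"
  where "is_hom \<phi>" "\<And>c. \<phi> (dconst c) = \<kappa> c" "\<And>i j. \<phi> (dvar i j) = v i j"
proof
  define ev where "ev m = (\<Prod>a\<in>Poly_Mapping.keys m. case_prod v a ^ Poly_Mapping.lookup m a)"
    for m :: "'n dmonom"
  define \<phi> where "\<phi> P = (\<Sum>m\<in>Poly_Mapping.keys P. \<kappa> (Poly_Mapping.lookup P m) * ev m)"
    for P :: "('k, 'n) dpoly"
  have ev: "ev m = (\<Prod>a\<in>A. case_prod v a ^ Poly_Mapping.lookup m a)"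
    if "finite A" "Poly_Mapping.keys m \<subseteq> A" for A m
    unfolding ev_def by (rule prod.mono_neutral_left) (use that in \<open>auto simp: in_keys_iff\<close>)
  have ev_add: "ev (m + m') = ev m * ev m'" for m m'
    using ev[of "Poly_Mapping.keys m \<union> Poly_Mapping.keys m'"] keys_add[of m m']
    by (simp add: lookup_add power_add prod.distrib)
  have \<phi>: "\<phi> P = (\<Sum>m\<in>A. \<kappa> (Poly_Mapping.lookup P m) * ev m)"
    if "finite A" "Poly_Mapping.keys P \<subseteq> A" for A P
    unfolding \<phi>_def
    by (rule sum.mono_neutral_left) (use that in \<open>auto simp: in_keys_iff hom_0[OF \<kappa>]\<close>)
  have \<phi>_add: "\<phi> (P + Q) = \<phi> P + \<phi> Q" for P Q
    using \<phi>[of "Poly_Mapping.keys P \<union> Poly_Mapping.keys Q"] keys_add[of P Q]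
    by (simp add: lookup_add hom_add[OF \<kappa>] distrib_right sum.distrib)
  have \<phi>_single: "\<phi> (Poly_Mapping.single m c) = \<kappa> c * ev m" for m c
    using \<phi>[of "{m}"] by simp
  have \<phi>_0: "\<phi> 0 = 0"
    by (simp add: \<phi>_def)
  have "\<phi> (Poly_Mapping.single m c * Q) = \<phi> (Poly_Mapping.single m c) * \<phi> Q" for m c Q
    by (induction Q rule: dpoly_induct)
      (simp_all add: \<phi>_0 \<phi>_add \<phi>_single mult_single ev_add hom_mult[OF \<kappa>] algebra_simps)
  then have "\<phi> (P * Q) = \<phi> P * \<phi> Q" for P Q
    by (induction P rule: dpoly_induct) (simp_all add: \<phi>_0 \<phi>_add distrib_right)
  moreover have "\<phi> 1 = 1"
    using \<phi>_single[of 0 1] by (simp add: ev_def hom_1[OF \<kappa>])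
  ultimately show "is_hom \<phi>"
    by (simp add: is_hom_def \<phi>_add)
  show "\<phi> (dconst c) = \<kappa> c" for c
    by (simp add: dconst_def \<phi>_single ev_def)
  show "\<phi> (dvar i j) = v i j" for i j
    by (simp add: dvar_def \<phi>_single ev_def hom_1[OF \<kappa>])
qed

lemma ex_dpoly_hom_jvar:
  fixes \<kappa> :: "'k::field_char_0 \<Rightarrow> 'b::comm_ring_1" and x :: "'n \<Rightarrow> nat \<Rightarrow> 'b"
  assumes \<kappa>: "is_hom \<kappa>"
  obtains \<phi> :: "('k, 'n) dpoly \<Rightarrow> 'b"
  where "is_hom \<phi>" "\<And>c. \<phi> (dconst c) = \<kappa> c" "\<And>i j. \<phi> (jvar i j) = x i j"
proof -
  obtain \<phi> :: "('k, 'n) dpoly \<Rightarrow> 'b" where \<phi>: "is_hom \<phi>" "\<And>c. \<phi> (dconst c) = \<kappa> c"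
    "\<And>i j. \<phi> (dvar i j) = \<kappa> (fact j) * x i j"
    using ex_dpoly_hom[OF \<kappa>, of "\<lambda>i j. \<kappa> (fact j) * x i j"] by metis
  have "\<phi> (jvar i j) = x i j" for i j
    unfolding jvar_def hom_mult[OF \<phi>(1)] \<phi>(2,3) mult.assoc[symmetric] hom_mult[OF \<kappa>, symmetric]
    by (simp add: hom_1[OF \<kappa>])
  then show ?thesis
    using that \<phi>(1,2) by blast
qed

section \<open>The first claim, by specialisation to powers of t\<close>

lemma prod_dvar_eq:
  fixes h :: "'n::finite \<Rightarrow> nat"
  shows "(\<Prod>i\<in>UNIV. dvar i (h i) :: ('k::field_char_0, 'n) dpoly) =
    dconst (\<Prod>i\<in>UNIV. fact (h i)) * (\<Prod>i\<in>UNIV. jvar i (h i))"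
  by (simp add: dvar_eq_jvar prod.distrib dconst_prod)

text \<open>Setting the series i to t^(h i) turns the product into t^H. All coefficients below H
  vanish, while the differential monomial goes to the product of the factorials of the h i, which is
  nonzero.\<close>

lemma prod_dvar_not_mem_radical:
  fixes \<delta> :: "'k::field_char_0 \<Rightarrow> 'k" and h :: "'n::finite \<Rightarrow> nat"
  assumes "derivation \<delta>"
  shows "(\<Prod>i\<in>UNIV. dvar i (h i)) \<notin> radical (I_ideal \<delta> (int (\<Sum>i\<in>UNIV. h i) - 1))"
proof
  define x where "x i j = (if j = h i then 1 else 0 :: 'k)" for i :: 'n and j
  define H where "H = (\<Sum>i\<in>UNIV. h i)"
  have "is_hom (\<lambda>c :: 'k. c)"
    by (simp add: is_hom_def)
  then obtain \<phi> :: "('k, 'n) dpoly \<Rightarrow> 'k" where \<phi>: "is_hom \<phi>" "\<And>c. \<phi> (dconst c) = c"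
    "\<And>i j. \<phi> (jvar i j) = x i j"
    using ex_dpoly_hom_jvar[of "\<lambda>c :: 'k. c" x] by metis
  assume "(\<Prod>i\<in>UNIV. dvar i (h i)) \<in> radical (I_ideal \<delta> (int (\<Sum>i\<in>UNIV. h i) - 1))"
  then obtain m where m: "(\<Prod>i\<in>UNIV. dvar i (h i) :: ('k, 'n) dpoly) ^ m \<in>
      ideal_gen (jet_coeff jvar ` {..<H})"
    unfolding I_ideal_eq[OF assms] by (auto simp: radical_def H_def)
  have "jet_coeff x l = 0" if "l < H" for l
    unfolding jet_coeff_eq
  proof (intro sum.neutral ballI)
    fix X :: "'n multiset" assume "X \<in> {X. size X = l}"
    then have "count X \<noteq> h"
      using that by (auto simp: size_eq_sum_count H_def)
    then obtain i where "count X i \<noteq> h i"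
      by auto
    then show "(\<Prod>i\<in>UNIV. x i (count X i)) = 0"
      by (intro prod_zero) (auto simp: x_def)
  qed
  then have "\<phi> a \<in> {0}" if "a \<in> jet_coeff jvar ` {..<H}" for a
    using that by (auto simp: hom_jet_coeff[OF \<phi>(1)] \<phi>(3))
  moreover have "is_ideal {0 :: 'k}"
    by (simp add: is_ideal_def)
  ultimately have "\<phi> ((\<Prod>i\<in>UNIV. dvar i (h i)) ^ m) \<in> {0}"
    using hom_ideal_gen[OF \<phi>(1)] m by blast
  then show False
    by (simp add: prod_dvar_eq hom_power[OF \<phi>(1)] hom_mult[OF \<phi>(1)] hom_prod[OF \<phi>(1)] \<phi>(2,3) x_def)
qed

section \<open>A functional on the coinvariant algebra\<close>

type_synonym 'k zpoly = "(nat \<Rightarrow>\<^sub>0 nat) \<Rightarrow>\<^sub>0 'k"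

definition zvar :: "nat \<Rightarrow> 'k::comm_ring_1 zpoly" where
  "zvar s = Poly_Mapping.single (Poly_Mapping.single s 1) 1"

text \<open>\<open>permutes\<close> demands the identity outside \<open>{..<N}\<close>, so an
  exponent vector is compared with a permutation on its first N entries only.\<close>

definition trunc_fun :: "nat \<Rightarrow> (nat \<Rightarrow> nat) \<Rightarrow> nat \<Rightarrow> nat" where
  "trunc_fun N \<alpha> s = (if s < N then \<alpha> s else s)"

definition alt :: "nat \<Rightarrow> (nat \<Rightarrow> nat) \<Rightarrow> int" where
  "alt N \<alpha> = (if trunc_fun N \<alpha> permutes {..<N} then sign (trunc_fun N \<alpha>) else 0)"

text \<open>
  Up to sign, the coefficient of the Vandermonde product in the antisymmetrisation of \<open>P\<close>.
\<close>

definition alt_functional :: "nat \<Rightarrow> 'k::comm_ring_1 zpoly \<Rightarrow> 'k" where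
  "alt_functional N P =
    (\<Sum>m\<in>Poly_Mapping.keys P. Poly_Mapping.lookup P m * of_int (alt N (Poly_Mapping.lookup m)))"

lemma alt_cong: "(\<And>s. s < N \<Longrightarrow> \<alpha> s = \<beta> s) \<Longrightarrow> alt N \<alpha> = alt N \<beta>"
proof -
  assume "\<And>s. s < N \<Longrightarrow> \<alpha> s = \<beta> s"
  then have "trunc_fun N \<alpha> = trunc_fun N \<beta>"
    by (auto simp: trunc_fun_def)
  then show ?thesis
    by (simp add: alt_def)
qed

lemma alt_transpose:
  assumes "s < N" "t < N" "s \<noteq> t"
  shows "alt N (\<alpha> \<circ> transpose s t) = - alt N \<alpha>"
proof -
  let ?\<tau> = "transpose s t"
  have \<tau>: "?\<tau> permutes {..<N}"
    using assms by (intro permutes_swap_id) auto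
  have eq: "trunc_fun N (\<alpha> \<circ> ?\<tau>) = trunc_fun N \<alpha> \<circ> ?\<tau>"
    using assms by (auto simp: trunc_fun_def fun_eq_iff transpose_def)
  have iff: "trunc_fun N \<alpha> \<circ> ?\<tau> permutes {..<N} \<longleftrightarrow> trunc_fun N \<alpha> permutes {..<N}"
  proof
    assume "trunc_fun N \<alpha> \<circ> ?\<tau> permutes {..<N}"
    from permutes_compose[OF \<tau> this] show "trunc_fun N \<alpha> permutes {..<N}"
      by (simp add: comp_assoc)
  qed (rule permutes_compose[OF \<tau>])
  show ?thesis
  proof (cases "trunc_fun N \<alpha> permutes {..<N}")
    case True
    have "permutation (trunc_fun N \<alpha>)" "permutation ?\<tau>"
      using True \<tau> permutation_permutes by blast+
    then show ?thesis
      using True assms by (simp add: alt_def eq iff sign_compose sign_swap_id)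
  qed (simp add: alt_def eq iff)
qed

lemma alt_large: "s < N \<Longrightarrow> N \<le> \<alpha> s \<Longrightarrow> alt N \<alpha> = 0"
  using permutes_in_image[of "trunc_fun N \<alpha>" "{..<N}" s] by (auto simp: alt_def trunc_fun_def)

text \<open>
  If \<open>\<alpha>\<close> takes a value twice, exchanging the two positions is a sign-reversing involution of
  the sum; if it does not, every \<open>\<alpha> + 1\<^sub>S\<close> has too large a sum to be a permutation.
\<close>

lemma sum_alt_subsets_eq_0:
  assumes "0 < r"
  shows "(\<Sum>S | S \<subseteq> {..<N} \<and> card S = r. alt N (\<lambda>s. \<alpha> s + (if s \<in> S then 1 else 0))) = 0"
    (is "sum ?f ?A = 0")
proof (cases "inj_on \<alpha> {..<N}")
  case True
  have "?f S = 0" if S: "S \<in> ?A" for S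
  proof (rule ccontr)
    let ?\<beta> = "\<lambda>s. \<alpha> s + (if s \<in> S then 1 else 0)"
    assume "?f S \<noteq> 0"
    then have perm: "trunc_fun N ?\<beta> permutes {..<N}"
      by (auto simp: alt_def split: if_splits)
    have "?\<beta> s < N" if "s < N" for s
      using permutes_in_image[OF perm, of s] that by (simp add: trunc_fun_def)
    then have "\<alpha> ` {..<N} \<subseteq> {..<N}"
      by (fastforce split: if_splits)
    then have "\<alpha> ` {..<N} = {..<N}"
      using True by (intro card_subset_eq) (auto simp: card_image)
    then have "(\<Sum>s<N. \<alpha> s) = \<Sum>{..<N}"
      using sum.reindex[OF True, of "\<lambda>x. x"] by simp
    moreover have "(\<Sum>s<N. ?\<beta> s) = \<Sum>{..<N}"
      using sum.permute[OF perm, of "\<lambda>x. x"] by (simp add: trunc_fun_def)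
    moreover have "(\<Sum>s<N. ?\<beta> s) = (\<Sum>s<N. \<alpha> s) + card S"
    proof -
      have "{..<N} \<inter> S = S"
        using S by auto
      then show ?thesis
        by (simp add: sum.distrib sum.If_cases)
    qed
    ultimately show False
      using assms S by simp
  qed
  then show ?thesis
    by simp
next
  case False
  then obtain s t where st: "s < N" "t < N" "s \<noteq> t" "\<alpha> s = \<alpha> t"
    by (auto simp: inj_on_def)
  let ?\<tau> = "transpose s t"
  have \<tau>: "?\<tau> permutes {..<N}"
    using st by (intro permutes_swap_id) auto
  have mem: "?\<tau> ` S \<in> ?A" if "S \<in> ?A" for S
    using that permutes_image[OF \<tau>] by (auto simp: card_image[OF inj_on_subset[OF permutes_inj[OF \<tau>]]])
  have "sum ?f ?A = (\<Sum>S\<in>?A. ?f (?\<tau> ` S))"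
    by (rule sum.reindex_bij_witness[of _ "image ?\<tau>" "image ?\<tau>"])
      (use mem in \<open>auto simp: image_comp comp_def\<close>)
  also have "\<dots> = (\<Sum>S\<in>?A. - ?f S)"
  proof (rule sum.cong)
    fix S
    have "x \<in> ?\<tau> ` S \<longleftrightarrow> ?\<tau> x \<in> S" for x
      by (metis image_iff transpose_involutory)
    moreover have "\<alpha> (?\<tau> x) = \<alpha> x" for x
      using st(4) by (auto simp: transpose_def)
    ultimately have "(\<lambda>x. \<alpha> x + (if x \<in> ?\<tau> ` S then 1 else 0)) =
        (\<lambda>x. \<alpha> x + (if x \<in> S then 1 else 0)) \<circ> ?\<tau>"
      by (simp add: fun_eq_iff)
    then show "?f (?\<tau> ` S) = - ?f S"
      using alt_transpose[OF st(1-3)] by simp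
  qed simp
  also have "\<dots> = - sum ?f ?A"
    by (rule sum_negf)
  finally show ?thesis
    by simp
qed

lemma alt_functional_superset:
  assumes "finite A" "Poly_Mapping.keys P \<subseteq> A"
  shows "alt_functional N P =
    (\<Sum>m\<in>A. Poly_Mapping.lookup P m * of_int (alt N (Poly_Mapping.lookup m)))"
  unfolding alt_functional_def
  by (rule sum.mono_neutral_left) (use assms in \<open>auto simp: in_keys_iff\<close>)

lemma alt_functional_0 [simp]: "alt_functional N 0 = 0"
  by (simp add: alt_functional_def)

lemma alt_functional_add: "alt_functional N (P + Q) = alt_functional N P + alt_functional N Q"
proof -
  let ?A = "Poly_Mapping.keys P \<union> Poly_Mapping.keys Q"
  note sup = alt_functional_superset[of ?A _ N]
  show ?thesis
    using sup[of P] sup[of Q] sup[of "P + Q"] keys_add[of P Q]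
    by (simp add: lookup_add distrib_right sum.distrib)
qed

lemma alt_functional_sum: "alt_functional N (sum f A) = (\<Sum>x\<in>A. alt_functional N (f x))"
  by (induction A rule: infinite_finite_induct) (auto simp: alt_functional_add)

lemma alt_functional_single:
  "alt_functional N (Poly_Mapping.single m c) = c * of_int (alt N (Poly_Mapping.lookup m))"
  using alt_functional_superset[of "{m}" "Poly_Mapping.single m c"] by simp

lemma prod_zvar:
  "finite S \<Longrightarrow> (\<Prod>s\<in>S. zvar s) = Poly_Mapping.single (\<Sum>s\<in>S. Poly_Mapping.single s 1) 1"
  by (induction S rule: finite_induct) (simp_all add: zvar_def mult_single)

lemma prod_X_minus_const_nth:
  fixes z :: "'b \<Rightarrow> 'a::comm_ring_1"
  assumes "finite B"
  shows "fps_nth (\<Prod>s\<in>B. fps_X - fps_const (z s)) m =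
    (\<Sum>S | S \<subseteq> B \<and> card S + m = card B. (-1) ^ card S * (\<Prod>s\<in>S. z s))"
proof -
  have const: "(\<Prod>s\<in>S. fps_const (z s)) = fps_const (\<Prod>s\<in>S. z s)" for S
    by (induction S rule: infinite_finite_induct) auto
  have sgn: "(-1) ^ n = fps_const ((-1) ^ n :: 'a)" for n
    by (simp flip: fps_const_power fps_const_neg)
  have "fps_nth ((-1) ^ card S * (\<Prod>s\<in>S. fps_const (z s)) * (\<Prod>s\<in>B - S. fps_X)) m =
      (if card S + m = card B then (-1) ^ card S * (\<Prod>s\<in>S. z s) else 0)" if "S \<subseteq> B" for S
  proof -
    have "card B = card S + card (B - S)"
      using that assms card_mono[OF assms that] by (simp add: card_Diff_subset finite_subset)
    then show ?thesis
      unfolding const sgn fps_const_mult prod_constant fps_mult_left_const_nth fps_X_power_nth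
      by auto
  qed
  then have "fps_nth (\<Prod>s\<in>B. fps_X - fps_const (z s)) m =
      (\<Sum>S\<in>Pow B. if card S + m = card B then (-1) ^ card S * (\<Prod>s\<in>S. z s) else 0)"
    unfolding prod_diff_conv_sum[OF assms] fps_sum_nth by (intro sum.cong) auto
  also have "\<dots> = (\<Sum>S | S \<subseteq> B \<and> card S + m = card B. (-1) ^ card S * (\<Prod>s\<in>S. z s))"
    using assms by (subst sum.inter_filter[symmetric]) (auto intro!: sum.cong)
  finally show ?thesis .
qed

text \<open>For m < N the coefficient is, up to sign, the elementary symmetric polynomial of degree
  N - m > 0. Multiplying a monomial by it produces the vanishing sum of
  \<open>sum_alt_subsets_eq_0\<close>, so the functional factors through the coinvariant
  algebra.\<close>

lemma alt_functional_mult_coeff: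
  fixes Q :: "'k::comm_ring_1 zpoly"
  assumes "m < N"
  shows "alt_functional N (Q * fps_nth (\<Prod>s<N. fps_X - fps_const (zvar s)) m) = 0"
proof (induction Q rule: dpoly_induct)
  case (2 \<gamma> c)
  let ?A = "{S. S \<subseteq> {..<N} \<and> card S = N - m}"
  have A: "{S. S \<subseteq> {..<N} \<and> card S + m = card {..<N}} = ?A"
    using assms by auto
  have "alt_functional N (Poly_Mapping.single \<gamma> c * ((-1) ^ card S * (\<Prod>s\<in>S. zvar s))) =
      (-1) ^ (N - m) * c * of_int (alt N (\<lambda>s. Poly_Mapping.lookup \<gamma> s + (if s \<in> S then 1 else 0)))"
    if S: "S \<in> ?A" for S
  proof -
    have fin: "finite S"
      using S finite_subset[of S "{..<N}"] by auto
    have "Poly_Mapping.lookup (\<gamma> + (\<Sum>s\<in>S. Poly_Mapping.single s 1)) =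
        (\<lambda>s. Poly_Mapping.lookup \<gamma> s + (if s \<in> S then 1 else 0))"
      using fin by (auto simp: fun_eq_iff lookup_add lookup_sum lookup_single when_def)
    moreover have "(-1) ^ n = (Poly_Mapping.single 0 ((-1) ^ n) :: 'k zpoly)" for n
    proof (induction n)
      case (Suc n)
      have "- Poly_Mapping.single 0 ((-1) ^ n) = Poly_Mapping.single 0 (- ((-1) ^ n :: 'k))"
        by (rule single_uminus[symmetric])
      with Suc show ?case
        by simp
    qed simp
    ultimately show ?thesis
      using S by (simp add: prod_zvar[OF fin] mult_single alt_functional_single mult_ac)
  qed
  then have "alt_functional N
      (Poly_Mapping.single \<gamma> c * fps_nth (\<Prod>s<N. fps_X - fps_const (zvar s)) m) =
    (\<Sum>S\<in>?A. (-1) ^ (N - m) * c *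
      of_int (alt N (\<lambda>s. Poly_Mapping.lookup \<gamma> s + (if s \<in> S then 1 else 0))))"
    unfolding prod_X_minus_const_nth[OF finite_lessThan] A
    by (simp add: sum_distrib_left alt_functional_sum)
  also have "\<dots> = (-1) ^ (N - m) * c *
      of_int (\<Sum>S\<in>?A. alt N (\<lambda>s. Poly_Mapping.lookup \<gamma> s + (if s \<in> S then 1 else 0)))"
    by (simp add: sum_distrib_left)
  also have "\<dots> = 0"
    using assms by (subst sum_alt_subsets_eq_0) auto
  finally show ?case .
qed (simp_all add: alt_functional_add distrib_right)

section \<open>Positivity\<close>

text \<open>The recursion expands d factors z_0 + ... + z_(k-1) one at a time, each raising one of
  the first k exponents; see \<open>alt_functional_power\<close>.\<close>

fun alt_walk :: "nat \<Rightarrow> nat \<Rightarrow> nat \<Rightarrow> (nat \<Rightarrow> nat) \<Rightarrow> int" where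
  "alt_walk N k 0 \<alpha> = alt N \<alpha>"
| "alt_walk N k (Suc d) \<alpha> = (\<Sum>s<k. alt_walk N k d (\<alpha>(s := Suc (\<alpha> s))))"

lemma alt_functional_power:
  "alt_functional N (Poly_Mapping.single \<gamma> c * (\<Sum>s<k. zvar s) ^ d) =
    (c :: 'k::comm_ring_1) * of_int (alt_walk N k d (Poly_Mapping.lookup \<gamma>))"
proof (induction d arbitrary: \<gamma>)
  case 0
  then show ?case
    by (simp add: alt_functional_single)
next
  case (Suc d)
  have "Poly_Mapping.single \<gamma> c * (\<Sum>s<k. zvar s) ^ Suc d =
      (\<Sum>s<k. Poly_Mapping.single (\<gamma> + Poly_Mapping.single s 1) c * (\<Sum>s<k. zvar s) ^ d)"
    by (simp add: zvar_def mult_single sum_distrib_left sum_distrib_right mult.assoc[symmetric])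
  moreover have "Poly_Mapping.lookup (\<gamma> + Poly_Mapping.single s 1) =
      (Poly_Mapping.lookup \<gamma>)(s := Suc (Poly_Mapping.lookup \<gamma> s))" for s
    by (auto simp: fun_eq_iff lookup_add lookup_single when_def)
  ultimately show ?case
    by (simp only: alt_functional_sum Suc.IH alt_walk.simps of_int_sum sum_distrib_left)
qed

text \<open>The sum z_0 + ... + z_(k-1) is symmetric, so multiplication by it preserves the
  antisymmetry of \<open>alt\<close> in the first k positions.\<close>

lemma alt_walk_transpose:
  assumes "s < k" "t < k" "s \<noteq> t" "k \<le> N"
  shows "alt_walk N k d (\<alpha> \<circ> transpose s t) = - alt_walk N k d \<alpha>"
proof (induction d arbitrary: \<alpha>)
  case 0
  then show ?case
    unfolding alt_walk.simps using assms by (intro alt_transpose) auto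
next
  case (Suc d)
  let ?\<tau> = "transpose s t"
  have \<tau>: "?\<tau> permutes {..<k}"
    using assms by (intro permutes_swap_id) auto
  have upd: "(\<alpha> \<circ> ?\<tau>)(r := Suc ((\<alpha> \<circ> ?\<tau>) r)) = \<alpha>(?\<tau> r := Suc (\<alpha> (?\<tau> r))) \<circ> ?\<tau>" for r
    by (auto simp: fun_eq_iff) (metis transpose_involutory)+
  have "alt_walk N k (Suc d) (\<alpha> \<circ> ?\<tau>) = (\<Sum>r<k. - alt_walk N k d (\<alpha>(?\<tau> r := Suc (\<alpha> (?\<tau> r)))))"
    unfolding alt_walk.simps upd Suc.IH ..
  also have "\<dots> = - (\<Sum>r<k. alt_walk N k d (\<alpha>(r := Suc (\<alpha> r))))"
    using sum.permute[OF \<tau>, of "\<lambda>r. alt_walk N k d (\<alpha>(r := Suc (\<alpha> r)))"]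
    by (simp add: sum_negf comp_def)
  finally show ?case
    by (simp only: alt_walk.simps)
qed

lemma alt_walk_repeated:
  assumes "s < k" "t < k" "s \<noteq> t" "k \<le> N" "\<alpha> s = \<alpha> t"
  shows "alt_walk N k d \<alpha> = 0"
proof -
  have "\<alpha> \<circ> transpose s t = \<alpha>"
    using assms(5) by (auto simp: fun_eq_iff transpose_def)
  then show ?thesis
    using alt_walk_transpose[OF assms(1-4), of d \<alpha>] by simp
qed

lemma alt_walk_large: "s < N \<Longrightarrow> N \<le> \<alpha> s \<Longrightarrow> alt_walk N k d \<alpha> = 0"
proof (induction d arbitrary: \<alpha>)
  case 0
  then show ?case
    by (simp add: alt_large)
next
  case (Suc d)
  then show ?case
    by (auto intro!: sum.neutral Suc.IH)
qed

text \<open>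
  \<open>alt_walk\<close> counts, up to a common sign, the ways of raising the strictly increasing sequence
  \<open>\<alpha> 0 < \<dots> < \<alpha> (k - 1)\<close> to \<open>m, \<dots>, m + k - 1\<close> by unit steps through strictly increasing
  sequences, that is, standard Young tableaux.
\<close>

definition target :: "nat \<Rightarrow> nat \<Rightarrow> nat \<Rightarrow> nat" where
  "target k m s = (if s < k then m + s else s - k)"

lemma alt_target_nonzero: "alt (k + m) (target k m) \<noteq> 0"
proof -
  let ?p = "trunc_fun (k + m) (target k m)"
  have "bij_betw ?p {..<k + m} {..<k + m}"
    by (rule bij_betw_byWitness[where f' = "\<lambda>s. if s < m then s + k else s - m"])
      (auto simp: trunc_fun_def target_def)
  then have "?p permutes {..<k + m}"
    by (rule bij_imp_permutes) (simp add: trunc_fun_def)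
  then show ?thesis
    by (simp add: alt_def)
qed

lemma alt_walk_pos:
  assumes "\<And>s. k \<le> s \<Longrightarrow> s < k + m \<Longrightarrow> \<alpha> s = s - k"
    and "\<And>s. Suc s < k \<Longrightarrow> \<alpha> s < \<alpha> (Suc s)"
    and "\<And>s. s < k \<Longrightarrow> \<alpha> s \<le> m + s"
    and "d = (\<Sum>s<k. m + s - \<alpha> s)"
  shows "0 < alt (k + m) (target k m) * alt_walk (k + m) k d \<alpha>"
  using assms
proof (induction d arbitrary: \<alpha>)
  case 0
  have "\<alpha> s = m + s" if "s < k" for s
    using 0(4) 0(3)[OF that] that by (simp add: le_antisym)
  then have "alt (k + m) \<alpha> = alt (k + m) (target k m)"
    using 0(1) by (intro alt_cong) (auto simp: target_def)
  then show ?case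
    using alt_target_nonzero[of k m] by (simp flip: power2_eq_square)
next
  case (Suc d)
  let ?\<alpha> = "\<lambda>s. \<alpha>(s := Suc (\<alpha> s))"
  let ?f = "\<lambda>s. alt (k + m) (target k m) * alt_walk (k + m) k d (?\<alpha> s)"
  have pos: "0 < ?f s" if s: "s < k" "\<alpha> s < m + s" "Suc s < k \<Longrightarrow> Suc (\<alpha> s) \<noteq> \<alpha> (Suc s)" for s
  proof (rule Suc.IH)
    show "?\<alpha> s r = r - k" if "k \<le> r" "r < k + m" for r
      using Suc.prems(1)[OF that] that s by auto
    show "?\<alpha> s r < ?\<alpha> s (Suc r)" if "Suc r < k" for r
      using Suc.prems(2)[OF that] that s by auto
    show "?\<alpha> s r \<le> m + r" if "r < k" for r
      using Suc.prems(3)[OF that] that s by auto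
    have "Suc d = (m + s - \<alpha> s) + (\<Sum>r\<in>{..<k} - {s}. m + r - \<alpha> r)"
      using Suc.prems(4) s by (simp add: sum.remove)
    moreover have "(\<Sum>r<k. m + r - ?\<alpha> s r) =
        (m + s - Suc (\<alpha> s)) + (\<Sum>r\<in>{..<k} - {s}. m + r - \<alpha> r)"
      using s by (simp add: sum.remove[of _ s])
    ultimately show "d = (\<Sum>r<k. m + r - ?\<alpha> s r)"
      using s by simp
  qed
  \<comment> \<open>Steps not covered by \<open>pos\<close> contribute zero: they create two equal
    exponents or, at s = k - 1, the exponent k + m, which is too large.\<close>
  have nonneg: "0 \<le> ?f s" if s: "s < k" for s
  proof -
    consider "\<alpha> s < m + s" "Suc s < k \<Longrightarrow> Suc (\<alpha> s) \<noteq> \<alpha> (Suc s)"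
      | "Suc s < k" "Suc (\<alpha> s) = \<alpha> (Suc s)"
      | "Suc s = k" "\<alpha> s = m + s"
      using Suc.prems(2)[of s] Suc.prems(3)[of s] Suc.prems(3)[of "Suc s"] s by linarith
    then show ?thesis
    proof cases
      case 1
      then show ?thesis
        using pos[of s] s by simp
    next
      case 2
      then have "alt_walk (k + m) k d (?\<alpha> s) = 0"
        by (intro alt_walk_repeated[of s k "Suc s"]) auto
      then show ?thesis
        by simp
    next
      case 3
      then have "alt_walk (k + m) k d (?\<alpha> s) = 0"
        by (intro alt_walk_large[of s]) auto
      then show ?thesis
        by simp
    qed
  qed
  let ?B = "{s. s < k \<and> \<alpha> s < m + s}"
  have "?B \<noteq> {}"
  proof
    assume "?B = {}"
    then have "m + s - \<alpha> s = 0" if "s < k" for s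
      using that by auto
    then have "(\<Sum>s<k. m + s - \<alpha> s) = 0"
      by (intro sum.neutral) simp
    then show False
      using Suc.prems(4) by simp
  qed
  \<comment> \<open>The last entry not yet at its final value can always be raised, because its
    successor, if any, is already at m + s + 1.\<close>
  define s where "s = Max ?B"
  have "finite ?B"
    by simp
  note s = Max_in[OF this \<open>?B \<noteq> {}\<close>, folded s_def] Max_ge[OF this, folded s_def]
  have "Suc (\<alpha> s) \<noteq> \<alpha> (Suc s)" if "Suc s < k"
    using s(1) s(2)[of "Suc s"] that Suc.prems(3)[of "Suc s"] by auto
  then have "0 < ?f s"
    using s(1) by (intro pos) auto
  then have "0 < (\<Sum>s<k. ?f s)"
    using s(1) nonneg by (intro sum_pos2[of _ s]) auto
  then show ?case
    by (simp add: sum_distrib_left)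
qed

text \<open>The first k exponents start at 0, ..., k - 1 and each must rise by m, which takes k * m
  steps; the last m stay at 0, ..., m - 1. The walks are the standard tableaux of a k by m
  rectangle.\<close>

lemma ex_alt_walk_nonzero:
  "\<exists>\<gamma>. alt_walk (k + m) k (k * m) (Poly_Mapping.lookup \<gamma>) \<noteq> 0"
proof -
  define f where "f s = (if s < k then s else s - k)" for s
  define \<gamma> where "\<gamma> = (\<Sum>s<k + m. Poly_Mapping.single s (f s))"
  have \<gamma>: "Poly_Mapping.lookup \<gamma> s = (if s < k + m then f s else 0)" for s
    by (simp add: \<gamma>_def lookup_sum lookup_single when_def)
  have "0 < alt (k + m) (target k m) * alt_walk (k + m) k (k * m) (Poly_Mapping.lookup \<gamma>)"
  proof (rule alt_walk_pos)
    show "k * m = (\<Sum>s<k. m + s - Poly_Mapping.lookup \<gamma> s)"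
      by (simp add: \<gamma> f_def)
  qed (simp_all add: \<gamma> f_def)
  then show ?thesis
    by (intro exI[of _ \<gamma>]) auto
qed

section \<open>Sharpness of the exponent\<close>

lemma ex_partition_card:
  assumes "finite J" "finite T" "card T = (\<Sum>j\<in>J. f j)"
  shows "\<exists>B. (\<forall>j\<in>J. finite (B j) \<and> card (B j) = f j) \<and> disjoint_family_on B J \<and> (\<Union>j\<in>J. B j) = T"
  using assms
proof (induction J arbitrary: T rule: finite_induct)
  case empty
  then show ?case
    by (auto simp: disjoint_family_on_def)
next
  case (insert j J)
  have "f j \<le> card T"
    using insert.hyps insert.prems by simp
  then obtain U where U: "U \<subseteq> T" "card U = f j" "finite U"
    by (rule obtain_subset_with_card_n)
  have "card (T - U) = (\<Sum>j\<in>J. f j)"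
    using insert.hyps insert.prems U by (simp add: card_Diff_subset)
  then obtain B where B: "\<forall>j\<in>J. finite (B j) \<and> card (B j) = f j" "disjoint_family_on B J"
    "(\<Union>j\<in>J. B j) = T - U"
    using insert.IH[of "T - U"] insert.prems by auto
  have "disjoint_family_on (B(j := U)) (insert j J)"
    using B(2,3) insert.hyps(2) unfolding disjoint_family_on_def by (auto split: if_splits)
  moreover have "(\<Union>i\<in>insert j J. (B(j := U)) i) = T"
    using B(3) U(1) insert.hyps(2) by (auto split: if_splits)
  moreover have "\<forall>i\<in>insert j J. finite ((B(j := U)) i) \<and> card ((B(j := U)) i) = f i"
    using B(1) U insert.prems(1) insert.hyps(2) by (auto intro: finite_subset)
  ultimately show ?case
    by blast
qed

lemma prod_dvar_power_not_mem:
  fixes \<delta> :: "'k::field_char_0 \<Rightarrow> 'k" and h :: "'n::finite \<Rightarrow> nat"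
  defines "H \<equiv> \<Sum>i\<in>UNIV. h i"
  assumes "derivation \<delta>"
  shows "(\<Prod>i\<in>UNIV. dvar i (h i)) ^ ((h i + 1) * (H - h i)) \<notin> I_ideal \<delta> (int H)"
proof
  define k where "k = h i + 1"
  define m where "m = H - h i"
  have Hi: "H = h i + (\<Sum>j\<in>UNIV - {i}. h j)"
    unfolding H_def by (rule sum.remove) auto
  then have N: "k + m = Suc H" and m: "m = (\<Sum>j\<in>UNIV - {i}. h j)"
    by (auto simp: k_def m_def)
  obtain B0 where B0: "\<forall>j\<in>UNIV - {i}. finite (B0 j) \<and> card (B0 j) = h j"
    "disjoint_family_on B0 (UNIV - {i})" "(\<Union>j\<in>UNIV - {i}. B0 j) = {k..<k + m}"
    using ex_partition_card[of "UNIV - {i}" "{k..<k + m}" h] m by auto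
  \<comment> \<open>The series i gets one factor more than h i, so its coefficient at h i is linear.
    Every other series j gets exactly h j factors, so its coefficient at h j is the leading 1. All k
    + m = H + 1 roots are used.\<close>
  define B where "B = B0(i := {..<k})"
  have fin: "finite (B j)" for j
    using B0(1) by (auto simp: B_def)
  have cardB: "card (B j) = h j" if "j \<noteq> i" for j
    using B0(1) that by (auto simp: B_def)
  have sub: "B0 j \<subseteq> {k..<k + m}" if "j \<noteq> i" for j
    using B0(3) that by blast
  have disj: "B j \<inter> B l = {}" if "j \<noteq> l" for j l
    using B0(2) sub[of j] sub[of l] that unfolding disjoint_family_on_def B_def
    by (auto split: if_splits) fastforce+
  have "(\<Union>j\<in>UNIV. B j) = B i \<union> (\<Union>j\<in>UNIV - {i}. B j)"
    by blast
  also have "(\<Union>j\<in>UNIV - {i}. B j) = {k..<k + m}"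
    unfolding B0(3)[symmetric] by (auto simp: B_def)
  finally have un: "(\<Union>j\<in>UNIV. B j) = {..<k + m}"
    by (auto simp: B_def)
  define x :: "'n \<Rightarrow> nat \<Rightarrow> 'k zpoly" where
    "x j = fps_nth (\<Prod>s\<in>B j. fps_X - fps_const (zvar s))" for j
  have jet: "jet_coeff x l = fps_nth (\<Prod>s<k + m. fps_X - fps_const (zvar s)) l" for l
    unfolding jet_coeff_def x_def fps_nth_inverse un[symmetric] using fin disj
    by (subst prod.UNION_disjoint) auto
  have xj: "x j (h j) = 1" if "j \<noteq> i" for j
  proof -
    have "{S. S \<subseteq> B j \<and> card S + h j = card (B j)} = {{}}"
      using cardB[OF that] finite_subset[OF _ fin[of j]] by auto
    then show ?thesis
      unfolding x_def prod_X_minus_const_nth[OF fin] by simp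
  qed
  have xi: "x i (h i) = - (\<Sum>s<k. zvar s)"
  proof -
    have "{S. S \<subseteq> B i \<and> card S + h i = card (B i)} = (\<lambda>s. {s}) ` {..<k}"
      by (auto simp: B_def k_def card_1_singleton_iff)
    then show ?thesis
      unfolding x_def prod_X_minus_const_nth[OF fin]
      by (simp add: sum.reindex sum_negf)
  qed
  have prodx: "(\<Prod>j\<in>UNIV. x j (h j)) = - (\<Sum>s<k. zvar s)"
    by (subst prod.remove[of _ i]) (auto simp: xj xi)
  \<comment> \<open>This is the largest ideal on which the functional vanishes. It contains the
    images of all generators, whereas \<open>ex_alt_walk_nonzero\<close> shows that it misses the
    image of the power.\<close>
  define J :: "'k zpoly set" where "J = {P. \<forall>Q. alt_functional (k + m) (Q * P) = 0}"
  have J: "is_ideal J"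
    unfolding J_def
    by (rule is_idealI) (auto simp: distrib_left alt_functional_add mult.assoc[symmetric])
  have "is_hom (Poly_Mapping.single 0 :: 'k \<Rightarrow> 'k zpoly)"
    by (simp add: is_hom_def single_add mult_single)
  then obtain \<phi> :: "('k, 'n) dpoly \<Rightarrow> 'k zpoly" where \<phi>: "is_hom \<phi>"
    "\<And>c. \<phi> (dconst c) = Poly_Mapping.single 0 c" "\<And>i j. \<phi> (jvar i j) = x i j"
    using ex_dpoly_hom_jvar[of "Poly_Mapping.single 0" x] by metis
  define c :: 'k where "c = (\<Prod>i\<in>UNIV. fact (h i))"
  have c: "c \<noteq> 0"
    by (simp add: c_def)
  let ?w = "(\<Prod>i\<in>UNIV. dvar i (h i)) :: ('k, 'n) dpoly"
  assume "?w ^ ((h i + 1) * (H - h i)) \<in> I_ideal \<delta> (int H)"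
  then have "?w ^ (k * m) \<in> ideal_gen (jet_coeff jvar ` {..<Suc H})"
    using I_ideal_eq[OF assms(2), of "Suc H", where 'n = 'n] by (simp add: k_def m_def)
  then have "\<phi> (?w ^ (k * m)) \<in> J"
  proof (rule hom_ideal_gen[OF \<phi>(1) J, rotated])
    fix a :: "('k, 'n) dpoly" assume "a \<in> jet_coeff jvar ` {..<Suc H}"
    then obtain l where l: "l < k + m" "a = jet_coeff jvar l"
      unfolding N by auto
    show "\<phi> a \<in> J"
      by (simp add: l(2) alt_functional_mult_coeff[OF l(1)] hom_jet_coeff[OF \<phi>(1)] \<phi>(3) jet J_def)
  qed
  moreover have "\<phi> (?w ^ (k * m)) =
      Poly_Mapping.single 0 ((- c) ^ (k * m)) * (\<Sum>s<k. zvar s) ^ (k * m)"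
  proof -
    have pow: "Poly_Mapping.single 0 a ^ n = (Poly_Mapping.single 0 (a ^ n) :: 'k zpoly)" for a n
      by (induction n) (simp_all add: mult_single)
    have "\<phi> ?w = Poly_Mapping.single 0 (- c) * (\<Sum>s<k. zvar s)"
      by (simp add: prod_dvar_eq hom_mult[OF \<phi>(1)] hom_prod[OF \<phi>(1)] \<phi>(2,3) prodx c_def single_uminus)
    then show ?thesis
      by (simp add: hom_power[OF \<phi>(1)] power_mult_distrib pow)
  qed
  ultimately have zero: "alt_functional (k + m)
      (Q * (Poly_Mapping.single 0 ((- c) ^ (k * m)) * (\<Sum>s<k. zvar s) ^ (k * m))) = 0" for Q
    by (simp add: J_def)
  obtain \<gamma> where "alt_walk (k + m) k (k * m) (Poly_Mapping.lookup \<gamma>) \<noteq> 0"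
    using ex_alt_walk_nonzero by blast
  moreover have "alt_functional (k + m)
      (Poly_Mapping.single \<gamma> ((- c) ^ (k * m)) * (\<Sum>s<k. zvar s) ^ (k * m)) = 0"
    using zero[of "Poly_Mapping.single \<gamma> 1"] by (simp add: mult.assoc[symmetric] mult_single)
  ultimately show False
    using c by (simp add: alt_functional_power)
qed

theorem theorem5p1:
  fixes \<delta> :: "'k::field_char_0 \<Rightarrow> 'k"
    and h :: "'n::finite \<Rightarrow> nat"
    and H :: nat
    and w :: "('k, 'n) dpoly"
  assumes "derivation \<delta>"
    and "H = (\<Sum>i\<in>UNIV. h i)"
    and "w = (\<Prod>i\<in>UNIV. dvar i (h i))"
  shows "w \<notin> radical (I_ideal \<delta> (int H - 1))
    \<and> (\<exists>d. w ^ d \<in> I_ideal \<delta> (int H))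
    \<and> (LEAST d. w ^ d \<in> I_ideal \<delta> (int H)) = Max (range (\<lambda>i. (h i + 1) * (H - h i))) + 1"
proof -
  define D where "D = Max (range (\<lambda>i. (h i + 1) * (H - h i)))"
  define I :: "('k, 'n) dpoly set" where "I = ideal_gen (jet_coeff jvar ` {..H})"
  have I: "I_ideal \<delta> (int H) = I"
    using I_ideal_eq[OF assms(1), of "Suc H", where 'n = 'n] by (simp add: I_def lessThan_Suc_atMost)
  have ideal: "is_ideal I"
    by (simp add: I_def)
  have "(h i + 1) * (H - h i) < D + 1" for i
    unfolding D_def by (simp add: le_imp_less_Suc)
  moreover have "nzd (jet_coeff jvar ` {..H}) (jet_coeff jvar (Suc H) :: ('k, 'n) dpoly)"
    using nzd_jet_coeff_jvar[of "Suc H", where 'k = 'k and 'n = 'n] by (simp add: lessThan_Suc_atMost)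
  ultimately have "(\<Prod>i\<in>UNIV. jvar i (h i)) ^ (D + 1) \<in> I"
    unfolding I_def assms(2) by (intro prod_power_mem) auto
  then have mem: "w ^ (D + 1) \<in> I"
    unfolding assms(3) prod_dvar_eq power_mult_distrib by (rule ideal_mult_left[OF ideal])
  have "D \<in> range (\<lambda>i. (h i + 1) * (H - h i))"
    unfolding D_def by (rule Max_in) auto
  then obtain i where i: "D = (h i + 1) * (H - h i)"
    by blast
  have "w ^ D \<notin> I"
    using prod_dvar_power_not_mem[OF assms(1), of h i] unfolding I[symmetric] i assms(2,3) .
  \<comment> \<open>Membership passes to higher powers, so its failure at D excludes every exponent
    up to D.\<close>
  then have "D + 1 \<le> d" if "w ^ d \<in> I" for d
    using ideal_dvd[OF ideal that le_imp_power_dvd[of d D w]] by linarith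
  with mem have "(LEAST d. w ^ d \<in> I) = D + 1"
    by (intro Least_equality)
  moreover have "w \<notin> radical (I_ideal \<delta> (int H - 1))"
    unfolding assms(2,3) by (rule prod_dvar_not_mem_radical[OF assms(1)])
  ultimately show ?thesis
    using mem unfolding I D_def by blast
qed

end
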